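(* Let $R$ be a ring with unity and let $\mathcal{X}$ be a semibrick of left $R$-modules. The category $\mathrm{Filt}(\mathcal{X})$ (as a full subcategory of the category of left $R$-modules) is closed under extensions, kernels and images.
   Context: A brick is a finitely presented left $R$-module whose endomorphism ring is a division ring. A semibrick is a class $\mathcal{X}$ of pairwise non-isomorphic bricks with $\mathrm{Hom}(X,X')=0$ for distinct $X,X'\in\mathcal{X}$. A filtration of a module $M$ is an ascending chain $(M_\lambda,\lambda\le\mu)$ of submodules ($\mu$ an ordinal) with $M_0=0$, $M_\mu=M$ and $M_\nu=\bigcup_{\lambda<\nu}M_\lambda$ for limit ordinals $\nu\le\mu$. It is an $\mathcal{X}$-filtration if each $M_{\lambda+1}/M_\lambda$ ($\lambda<\mu$) is isomorphic to a module in $\mathcal{X}$. $\mathrm{Filt}(\mathcal{X})$ is the class of modules admitting an $\mathcal{X}$-filtration. Closed under kernels (images) means that for every homomorphism $f:M\to N$ with $M,N\in\mathrm{Filt}(\mathcal{X})$ the kernel (image) of $f$ in the category of all $R$-modules lies in $\mathrm{Filt}(\mathcal{X})$. *)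

theory Defs
  imports "HOL-Algebra.Module" "HOL-Algebra.AbelCoset"
begin

text \<open>
  HOL-Algebra's locale \<open>module\<close> requires a commutative base ring; this is the same locale over an
  arbitrary (unital) ring. As there, the fields \<open>mult\<close> and \<open>one\<close> of a module record carry no
  meaning; they are left \<open>undefined\<close> in the constructions below.
\<close>

locale left_module = R?: ring R + M?: abelian_group M
  for R :: "('a, 'r) ring_scheme" (structure) and M :: "('a, 'b) module" (structure) +
  assumes smult_closed [simp, intro]:
      "\<lbrakk>a \<in> carrier R; x \<in> carrier M\<rbrakk> \<Longrightarrow> a \<odot>\<^bsub>M\<^esub> x \<in> carrier M"
    and smult_l_distr:
      "\<lbrakk>a \<in> carrier R; b \<in> carrier R; x \<in> carrier M\<rbrakk> \<Longrightarrow>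
      (a \<oplus> b) \<odot>\<^bsub>M\<^esub> x = a \<odot>\<^bsub>M\<^esub> x \<oplus>\<^bsub>M\<^esub> b \<odot>\<^bsub>M\<^esub> x"
    and smult_r_distr:
      "\<lbrakk>a \<in> carrier R; x \<in> carrier M; y \<in> carrier M\<rbrakk> \<Longrightarrow>
      a \<odot>\<^bsub>M\<^esub> (x \<oplus>\<^bsub>M\<^esub> y) = a \<odot>\<^bsub>M\<^esub> x \<oplus>\<^bsub>M\<^esub> a \<odot>\<^bsub>M\<^esub> y"
    and smult_assoc1:
      "\<lbrakk>a \<in> carrier R; b \<in> carrier R; x \<in> carrier M\<rbrakk> \<Longrightarrow>
      (a \<otimes> b) \<odot>\<^bsub>M\<^esub> x = a \<odot>\<^bsub>M\<^esub> (b \<odot>\<^bsub>M\<^esub> x)"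
    and smult_one [simp]:
      "x \<in> carrier M \<Longrightarrow> \<one> \<odot>\<^bsub>M\<^esub> x = x"

definition lmod_hom ::
  "('a, 'r) ring_scheme \<Rightarrow> ('a, 'b) module \<Rightarrow> ('a, 'c) module \<Rightarrow> ('b \<Rightarrow> 'c) set" where
  "lmod_hom R M N = {f \<in> carrier M \<rightarrow> carrier N.
     (\<forall>x\<in>carrier M. \<forall>y\<in>carrier M. f (x \<oplus>\<^bsub>M\<^esub> y) = f x \<oplus>\<^bsub>N\<^esub> f y) \<and>
     (\<forall>a\<in>carrier R. \<forall>x\<in>carrier M. f (a \<odot>\<^bsub>M\<^esub> x) = a \<odot>\<^bsub>N\<^esub> f x)}"

definition lmod_isomorphic ::
  "('a, 'r) ring_scheme \<Rightarrow> ('a, 'b) module \<Rightarrow> ('a, 'c) module \<Rightarrow> bool" where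
  "lmod_isomorphic R M N \<longleftrightarrow> (\<exists>f\<in>lmod_hom R M N. bij_betw f (carrier M) (carrier N))"

definition lmod_quot :: "('a, 'b) module \<Rightarrow> 'b set \<Rightarrow> ('a, 'b set) module" where
  "lmod_quot M H =
    \<lparr>carrier = a_rcosets\<^bsub>M\<^esub> H, mult = undefined, one = undefined,
     zero = H, add = set_add M,
     smult = (\<lambda>a C. \<Union>c\<in>C. H +>\<^bsub>M\<^esub> (a \<odot>\<^bsub>M\<^esub> c))\<rparr>"

definition free_lmod :: "('a, 'r) ring_scheme \<Rightarrow> nat \<Rightarrow> ('a, nat \<Rightarrow> 'a) module" where
  "free_lmod R n =
    \<lparr>carrier = {..<n} \<rightarrow>\<^sub>E carrier R, mult = undefined, one = undefined,
     zero = (\<lambda>i\<in>{..<n}. \<zero>\<^bsub>R\<^esub>),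
     add = (\<lambda>x y. \<lambda>i\<in>{..<n}. x i \<oplus>\<^bsub>R\<^esub> y i),
     smult = (\<lambda>a x. \<lambda>i\<in>{..<n}. a \<otimes>\<^bsub>R\<^esub> x i)\<rparr>"

text \<open>There is an exact sequence \<open>R\<^sup>m \<rightarrow> R\<^sup>n \<rightarrow> M \<rightarrow> 0\<close>.\<close>

definition finitely_presented :: "('a, 'r) ring_scheme \<Rightarrow> ('a, 'b) module \<Rightarrow> bool" where
  "finitely_presented R M \<longleftrightarrow> left_module R M \<and>
    (\<exists>m n. \<exists>f\<in>lmod_hom R (free_lmod R m) (free_lmod R n). \<exists>g\<in>lmod_hom R (free_lmod R n) M.
       f ` carrier (free_lmod R m) = a_kernel (free_lmod R n) M g \<and>
       g ` carrier (free_lmod R n) = carrier M)"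

text \<open>
  Endomorphisms are taken extensional, so that equality of elements of the endomorphism ring is
  equality of maps on the carrier.
\<close>

definition lmod_End :: "('a, 'r) ring_scheme \<Rightarrow> ('a, 'b) module \<Rightarrow> ('b \<Rightarrow> 'b) ring" where
  "lmod_End R M =
    \<lparr>carrier = lmod_hom R M M \<inter> extensional (carrier M),
     mult = compose (carrier M), one = (\<lambda>x\<in>carrier M. x),
     zero = (\<lambda>x\<in>carrier M. \<zero>\<^bsub>M\<^esub>),
     add = (\<lambda>f g. \<lambda>x\<in>carrier M. f x \<oplus>\<^bsub>M\<^esub> g x)\<rparr>"

definition division_ring :: "('a, 'r) ring_scheme \<Rightarrow> bool" where
  "division_ring D \<longleftrightarrow> ring D \<and> \<one>\<^bsub>D\<^esub> \<noteq> \<zero>\<^bsub>D\<^esub> \<and> Units D = carrier D - {\<zero>\<^bsub>D\<^esub>}"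

definition brick :: "('a, 'r) ring_scheme \<Rightarrow> ('a, 'b) module \<Rightarrow> bool" where
  "brick R M \<longleftrightarrow> left_module R M \<and> finitely_presented R M \<and> division_ring (lmod_End R M)"

definition semibrick :: "('a, 'r) ring_scheme \<Rightarrow> ('a, 'x) module set \<Rightarrow> bool" where
  "semibrick R \<X> \<longleftrightarrow> (\<forall>A\<in>\<X>. brick R A) \<and>
    (\<forall>A\<in>\<X>. \<forall>B\<in>\<X>. A \<noteq> B \<longrightarrow> \<not> lmod_isomorphic R A B \<and>
       (\<forall>f\<in>lmod_hom R A B. \<forall>x\<in>carrier A. f x = \<zero>\<^bsub>B\<^esub>))"

text \<open>
  An ordinal is represented by a well-order \<open>r\<close>, whose elements stand for the smaller ordinals.
  \<open>HOL-Cardinals\<close> counts zero as a limit; here a limit is nonzero.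
\<close>

definition wo_zero :: "'o rel \<Rightarrow> 'o \<Rightarrow> bool" where
  "wo_zero r i \<longleftrightarrow> i \<in> Field r \<and> underS r i = {}"

definition wo_succ :: "'o rel \<Rightarrow> 'o \<Rightarrow> 'o \<Rightarrow> bool" where
  "wo_succ r i j \<longleftrightarrow> i \<in> Field r \<and> j \<in> Field r \<and> underS r j = under r i"

definition wo_limit :: "'o rel \<Rightarrow> 'o \<Rightarrow> bool" where
  "wo_limit r j \<longleftrightarrow> j \<in> Field r \<and> \<not> wo_zero r j \<and> (\<nexists>i. wo_succ r i j)"

text \<open>
  The index set \<open>{\<lambda>. \<lambda> \<le> \<mu>}\<close> is the field of a well-order \<open>r\<close> with a greatest element, which
  plays the role of \<open>\<mu>\<close>.
\<close>

definition filtration ::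
  "('a, 'r) ring_scheme \<Rightarrow> ('a, 'b) module \<Rightarrow> 'o rel \<Rightarrow> ('o \<Rightarrow> 'b set) \<Rightarrow> bool" where
  "filtration R M r S \<longleftrightarrow> Well_order r \<and>
    (\<forall>i\<in>Field r. submodule (S i) R M) \<and>
    (\<forall>i j. (i, j) \<in> r \<longrightarrow> S i \<subseteq> S j) \<and>
    (\<forall>i. wo_zero r i \<longrightarrow> S i = {\<zero>\<^bsub>M\<^esub>}) \<and>
    (\<forall>j. wo_limit r j \<longrightarrow> S j = (\<Union>i\<in>underS r j. S i)) \<and>
    (\<exists>\<mu>\<in>Field r. (\<forall>i\<in>Field r. (i, \<mu>) \<in> r) \<and> S \<mu> = carrier M)"

definition filtration_by ::
  "('a, 'r) ring_scheme \<Rightarrow> ('a, 'x) module set \<Rightarrow> ('a, 'b) module \<Rightarrow> 'o rel \<Rightarrow>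
   ('o \<Rightarrow> 'b set) \<Rightarrow> bool" where
  "filtration_by R \<X> M r S \<longleftrightarrow> filtration R M r S \<and>
    (\<forall>i j. wo_succ r i j \<longrightarrow>
       (\<exists>A\<in>\<X>. lmod_isomorphic R (lmod_quot (M\<lparr>carrier := S j\<rparr>) (S i)) A))"

text \<open>
  The ordinal has to live on some type. For a semibrick the choice \<open>'b set\<close> is no restriction, by
  \<open>Filt_if_filtration_by\<close> below: the factors are nonzero, so the chain itself is a copy of its
  index set.
\<close>

definition Filt ::
  "('a, 'r) ring_scheme \<Rightarrow> ('a, 'x) module set \<Rightarrow> ('a, 'b) module set" where
  "Filt R \<X> = {M. left_module R M \<and> (\<exists>(r :: 'b set rel) S. filtration_by R \<X> M r S)}"

definition short_exact ::
  "('a, 'r) ring_scheme \<Rightarrow> ('a, 'l) module \<Rightarrow> ('l \<Rightarrow> 'e) \<Rightarrow> ('a, 'e) module \<Rightarrow> ('e \<Rightarrow> 'n) \<Rightarrow>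
   ('a, 'n) module \<Rightarrow> bool" where
  "short_exact R L f E g N \<longleftrightarrow>
    left_module R L \<and> left_module R E \<and> left_module R N \<and>
    f \<in> lmod_hom R L E \<and> g \<in> lmod_hom R E N \<and>
    inj_on f (carrier L) \<and> f ` carrier L = a_kernel E N g \<and> g ` carrier E = carrier N"

lemma (in left_module) ring_lmod_End: "ring (lmod_End R M)"
proof (rule ringI)
  let ?E = "lmod_End R M"
  note defs = lmod_End_def lmod_hom_def
  show "abelian_group ?E"
  proof (rule abelian_groupI)
    fix f assume f: "f \<in> carrier ?E"
    let ?g = "\<lambda>x\<in>carrier M. \<ominus>\<^bsub>M\<^esub> f x"
    have neg: "\<ominus>\<^bsub>M\<^esub> (a \<odot>\<^bsub>M\<^esub> y) = a \<odot>\<^bsub>M\<^esub> (\<ominus>\<^bsub>M\<^esub> y)"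
      if "a \<in> carrier R" "y \<in> carrier M" for a y
    proof -
      have z: "a \<odot>\<^bsub>M\<^esub> \<zero>\<^bsub>M\<^esub> = \<zero>\<^bsub>M\<^esub>"
        using that smult_r_distr[of a "\<zero>\<^bsub>M\<^esub>" "\<zero>\<^bsub>M\<^esub>"]
        by (metis M.add.r_cancel_one M.l_zero M.zero_closed smult_closed)
      have "a \<odot>\<^bsub>M\<^esub> (\<ominus>\<^bsub>M\<^esub> y) \<oplus>\<^bsub>M\<^esub> a \<odot>\<^bsub>M\<^esub> y = \<zero>\<^bsub>M\<^esub>"
        using that smult_r_distr[of a "\<ominus>\<^bsub>M\<^esub> y" y] z by (simp add: M.l_neg)
      then show ?thesis
        using that by (simp add: M.minus_equality)
    qed
    have "?g \<in> carrier ?E"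
      using f neg by (auto simp: defs Pi_iff M.minus_add)
    moreover have "?g \<oplus>\<^bsub>?E\<^esub> f = \<zero>\<^bsub>?E\<^esub>"
      using f by (auto simp: defs Pi_iff M.l_neg intro!: restrict_ext)
    ultimately show "\<exists>g\<in>carrier ?E. g \<oplus>\<^bsub>?E\<^esub> f = \<zero>\<^bsub>?E\<^esub>" by blast
  next
    have "a \<odot>\<^bsub>M\<^esub> \<zero>\<^bsub>M\<^esub> = \<zero>\<^bsub>M\<^esub>" if "a \<in> carrier R" for a
      using that smult_r_distr[of a "\<zero>\<^bsub>M\<^esub>" "\<zero>\<^bsub>M\<^esub>"]
      by (metis M.add.r_cancel_one M.l_zero M.zero_closed smult_closed)
    then show "\<zero>\<^bsub>?E\<^esub> \<in> carrier ?E" by (auto simp: defs)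
  qed (auto simp: defs Pi_iff smult_r_distr M.a_ac extensional_def intro!: restrict_ext ext)
  show "monoid ?E"
    by (rule monoidI)
       (auto simp: defs Pi_iff compose_def extensional_def intro!: restrict_ext ext)
qed (auto simp: lmod_End_def lmod_hom_def Pi_iff compose_def intro!: restrict_ext)

lemma Filt_if_filtration_by:
  fixes r :: "'o rel" and M :: "('a, 'b) module"
  assumes X: "semibrick R \<X>" and M: "left_module R M" and F: "filtration_by R \<X> M r S"
  shows "M \<in> Filt R \<X>"
proof -
  interpret M: left_module R M by fact
  have wo: "Well_order r" and sub: "\<And>i. i \<in> Field r \<Longrightarrow> submodule (S i) R M"
    and mono: "\<And>i j. (i, j) \<in> r \<Longrightarrow> S i \<subseteq> S j"
    and zeroS: "\<And>i. wo_zero r i \<Longrightarrow> S i = {\<zero>\<^bsub>M\<^esub>}"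
    and limS: "\<And>j. wo_limit r j \<Longrightarrow> S j = (\<Union>i\<in>underS r j. S i)"
    and sucS: "\<And>i j. wo_succ r i j \<Longrightarrow>
      \<exists>A\<in>\<X>. lmod_isomorphic R (lmod_quot (M\<lparr>carrier := S j\<rparr>) (S i)) A"
    using F unfolding filtration_by_def filtration_def by blast+
  interpret r: wo_rel r by (simp add: wo wo_rel.intro)
  have strict: "S i \<noteq> S j" if ij: "wo_succ r i j" for i j
  proof
    assume eq: "S i = S j"
    from F ij obtain A where A: "A \<in> \<X>"
      and "lmod_isomorphic R (lmod_quot (M\<lparr>carrier := S j\<rparr>) (S i)) A"
      by (auto simp: filtration_by_def)
    then obtain f where f: "bij_betw f (a_rcosets\<^bsub>M\<lparr>carrier := S j\<rparr>\<^esub> (S i)) (carrier A)"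
      by (auto simp: lmod_isomorphic_def lmod_quot_def)
    have sg: "subgroup (S j) (add_monoid M)"
      using sub[of j] ij by (auto simp: wo_succ_def submodule_def)
    have "C = S i" if "C \<in> a_rcosets\<^bsub>M\<lparr>carrier := S j\<rparr>\<^esub> (S i)" for C
      using that eq M.add.coset_join2[OF _ sg] subgroup.mem_carrier[OF sg]
      by (auto simp: A_RCOSETS_def RCOSETS_def r_coset_def a_r_coset_def)
    then have "carrier A \<subseteq> {f (S i)}"
      using f by (auto simp: bij_betw_def)
    then have triv: "x = y" if "x \<in> carrier A" "y \<in> carrier A" for x y
      using that by blast
    have br: "brick R A" using X A by (simp add: semibrick_def)
    then interpret A: left_module R A by (simp add: brick_def)
    have "(\<lambda>x\<in>carrier A. x) = (\<lambda>x\<in>carrier A. \<zero>\<^bsub>A\<^esub>)"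
      using triv A.M.zero_closed by (intro restrict_ext) blast
    with br show False by (simp add: brick_def division_ring_def lmod_End_def)
  qed
  have ne: "S i \<noteq> S j" if ij: "(i, j) \<in> r" "i \<noteq> j" for i j
  proof -
    have fld: "i \<in> Field r" "j \<in> Field r" using ij by (auto simp: Field_def)
    have ab: "AboveS r {i} \<noteq> {}" using ij fld by (auto simp: AboveS_def)
    let ?k = "r.suc {i}"
    have k: "?k \<in> AboveS r {i}" by (rule r.suc_AboveS) (use fld ab in auto)
    then have k': "?k \<in> Field r" "(i, ?k) \<in> r" "?k \<noteq> i" by (auto simp: AboveS_def)
    have kj: "(?k, j) \<in> r"
      by (rule r.suc_least_AboveS) (use ij fld in \<open>auto simp: AboveS_def\<close>)
    have "underS r ?k = under r i"
    proof (intro equalityI subsetI)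
      fix x assume x: "x \<in> underS r ?k"
      then have xk: "x \<noteq> ?k" "(x, ?k) \<in> r" by (auto simp: underS_def)
      then have xf: "x \<in> Field r" by (auto simp: Field_def)
      show "x \<in> under r i"
      proof (rule ccontr)
        assume "x \<notin> under r i"
        then have "(i, x) \<in> r" "x \<noteq> i"
          using xf fld r.TOTALS r.REFL by (auto simp: under_def refl_on_def)
        then have "(?k, x) \<in> r"
          by (intro r.suc_least_AboveS) (use xf in \<open>auto simp: AboveS_def\<close>)
        then show False using xk r.ANTISYM by (auto dest: antisymD)
      qed
    next
      fix x assume "x \<in> under r i"
      then have "(x, i) \<in> r" by (simp add: under_def)
      then show "x \<in> underS r ?k"
        using k' r.TRANS r.ANTISYM by (auto simp: underS_def dest: transD antisymD)
    qed
    then have "wo_succ r i ?k" using fld k' by (simp add: wo_succ_def)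
    from strict[OF this] mono[OF kj] mono[OF k'(2)] show ?thesis by auto
  qed
  have inj: "inj_on S (Field r)"
  proof (rule inj_onI, rule ccontr)
    fix i j assume ij: "i \<in> Field r" "j \<in> Field r" "S i = S j" "i \<noteq> j"
    then have "(i, j) \<in> r \<or> (j, i) \<in> r" using r.TOTALS by blast
    then show False using ij ne[of i j] ne[of j i] by auto
  qed
  let ?r = "dir_image r S"
  have wo': "Well_order ?r" using Well_order_dir_image[OF wo inj] .
  have fld': "Field ?r = S ` Field r" by (rule dir_image_Field)
  have mem: "(S i, S j) \<in> ?r \<longleftrightarrow> (i, j) \<in> r" if "i \<in> Field r" "j \<in> Field r" for i j
  proof
    assume "(S i, S j) \<in> ?r"
    then obtain a b where ab: "S i = S a" "S j = S b" "(a, b) \<in> r"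
      by (auto simp: dir_image_def)
    then have "a \<in> Field r" "b \<in> Field r" by (auto intro: FieldI1 FieldI2)
    then show "(i, j) \<in> r" using ab that inj by (metis inj_onD)
  qed (auto simp: dir_image_def)
  have rF: "I \<in> S ` Field r" "J \<in> S ` Field r" if "(I, J) \<in> ?r" for I J
    using that fld' by (metis FieldI1, metis FieldI2)
  have und: "under ?r (S i) = S ` under r i" if i: "i \<in> Field r" for i
  proof (intro equalityI subsetI)
    fix I assume "I \<in> under ?r (S i)"
    then have I: "(I, S i) \<in> ?r" by (simp add: under_def)
    from rF(1)[OF I] obtain k where "k \<in> Field r" "I = S k" by blast
    then show "I \<in> S ` under r i" using I mem i by (auto simp: under_def)
  qed (auto simp: under_def dir_image_def)
  have undS: "underS ?r (S i) = S ` underS r i" if i: "i \<in> Field r" for i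
  proof -
    have "underS ?r (S i) = under ?r (S i) - {S i}" by (auto simp: underS_def under_def)
    also have "\<dots> = S ` under r i - S ` {i}" using und[OF i] by simp
    also have "\<dots> = S ` (under r i - {i})"
      by (rule inj_on_image_set_diff[OF inj, symmetric]) (use i in \<open>auto simp: under_def Field_def\<close>)
    also have "under r i - {i} = underS r i" by (auto simp: underS_def under_def)
    finally show ?thesis .
  qed
  have sf: "under r i \<subseteq> Field r" "underS r i \<subseteq> Field r" for i
    by (auto simp: under_def underS_def Field_def)
  have zer: "wo_zero ?r (S i) \<longleftrightarrow> wo_zero r i" if "i \<in> Field r" for i
    using that by (auto simp: wo_zero_def fld' undS)
  have suc: "wo_succ ?r (S i) (S j) \<longleftrightarrow> wo_succ r i j" if "i \<in> Field r" "j \<in> Field r" for i j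
    using that inj_on_image_eq_iff[OF inj sf(2) sf(1)] by (auto simp: wo_succ_def fld' und undS)
  have lim: "wo_limit ?r (S j) \<longleftrightarrow> wo_limit r j" if "j \<in> Field r" for j
  proof -
    have "(\<exists>I. wo_succ ?r I (S j)) \<longleftrightarrow> (\<exists>i. wo_succ r i j)"
    proof
      assume "\<exists>I. wo_succ ?r I (S j)"
      then obtain I where I: "wo_succ ?r I (S j)" by blast
      then obtain i where "i \<in> Field r" "I = S i" by (auto simp: wo_succ_def fld')
      then show "\<exists>i. wo_succ r i j" using I suc[OF _ that] by blast
    next
      assume "\<exists>i. wo_succ r i j"
      then obtain i where i: "wo_succ r i j" by blast
      then have "i \<in> Field r" by (simp add: wo_succ_def)
      then show "\<exists>I. wo_succ ?r I (S j)" using i suc[OF _ that] by blast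
    qed
    then show ?thesis unfolding wo_limit_def fld' using that zer[OF that] by blast
  qed
  have "filtration R M ?r id"
    unfolding filtration_def
  proof (intro conjI allI impI ballI)
    show "Well_order ?r" by (rule wo')
    fix I assume "I \<in> Field ?r"
    then show "submodule (id I) R M" using sub by (auto simp: fld')
  next
    fix I J assume "(I, J) \<in> ?r"
    then show "id I \<subseteq> id J" using mono by (auto simp: dir_image_def)
  next
    fix I assume I: "wo_zero ?r I"
    then obtain i where "i \<in> Field r" "I = S i" by (auto simp: wo_zero_def fld')
    then show "id I = {\<zero>\<^bsub>M\<^esub>}" using I zer zeroS by simp
  next
    fix J assume J: "wo_limit ?r J"
    then obtain j where j: "j \<in> Field r" "J = S j" by (auto simp: wo_limit_def fld')
    then have "S j = (\<Union>i\<in>underS r j. S i)"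
      using J lim limS by blast
    then show "id J = (\<Union>I\<in>underS ?r J. id I)"
      unfolding j(2) undS[OF j(1)] by simp
  next
    from F obtain m where m: "m \<in> Field r" "\<forall>i\<in>Field r. (i, m) \<in> r" "S m = carrier M"
      unfolding filtration_by_def filtration_def by blast
    from m(1,2) have "\<forall>I\<in>Field ?r. (I, S m) \<in> ?r" using mem by (simp add: fld')
    moreover have "S m \<in> Field ?r" using m(1) fld' by blast
    ultimately show "\<exists>m\<in>Field ?r. (\<forall>i\<in>Field ?r. (i, m) \<in> ?r) \<and> id m = carrier M"
      using m(3) by (metis id_apply)
  qed
  moreover have "\<exists>A\<in>\<X>. lmod_isomorphic R (lmod_quot (M\<lparr>carrier := id J\<rparr>) (id I)) A"
    if IJ: "wo_succ ?r I J" for I J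
  proof -
    from IJ obtain i j where ij: "i \<in> Field r" "I = S i" "j \<in> Field r" "J = S j"
      unfolding wo_succ_def fld' by blast
    then have "wo_succ r i j" using IJ suc by blast
    from sucS[OF this] show ?thesis by (simp add: ij)
  qed
  ultimately have "filtration_by R \<X> M ?r id" by (simp add: filtration_by_def)
  with M show ?thesis by (auto simp: Filt_def)
qed

end

theory Submission
  imports Defs
begin

text \<open>
  Describe a filtration by its range, a set \<open>C\<close> of submodules well-ordered by inclusion, and write \<open>U\<close>
  for the union of the members of \<open>C\<close> strictly below \<open>B \<in> C\<close>. Call a submodule \<open>K\<close> compatible with \<open>C\<close>
  if for every \<open>B \<in> C\<close> the submodule \<open>B \<inter> (U + K)\<close> is either \<open>B\<close> or \<open>U\<close>. For such \<open>K\<close>, intersecting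
  with \<open>C\<close> yields a filtration of \<open>K\<close> whose factors are factors of \<open>C\<close> or zero.

  Let \<open>h : M \<rightarrow> N\<close> be a homomorphism between filtered modules. Transfinite induction along the filtration
  of \<open>M\<close> shows that the images of its members are compatible with the filtration of \<open>N\<close>, and that
  \<open>h\<close> induces on each factor \<open>Q / P\<close> of \<open>M\<close> a map to \<open>N / h P\<close> which is zero or injective. The first
  statement gives images, the second says that the kernel is compatible with the filtration of \<open>M\<close>.
\<close>

subsection \<open>Submodules, homomorphisms and factors\<close>

text \<open>Bricks need not be simple, so a submodule may meet a factor of a filtration in a proper
  nonzero submodule about which nothing is known. Only submodules that come from homomorphisms
  between filtered modules are under control. The obstacle is that the target \<open>N / h P\<close>
  of the induced map carries no given filtration. Compatibility of \<open>h P\<close> supplies one: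
  at a successor member \<open>B\<close> not contained in \<open>U + h P\<close> it gives
  \<open>B \<inter> (U + h P) = U\<close>, so \<open>(B + h P) / (U + h P)\<close> is still
  isomorphic to \<open>B / U\<close>, a member of the semibrick, and every map from
  \<open>Q / P\<close> to it is zero or an isomorphism. This is why compatibility of images and the
  dichotomy on factors are proved in one step. Finite generation of bricks enters once, to give the
  image of \<open>Q / P\<close> a definite top factor instead of letting it end at a limit.
  Extensions take another route: two chains are glued at the kernel of the surjection.\<close>

lemma set_addI: "a \<in> A \<Longrightarrow> b \<in> B \<Longrightarrow> a \<oplus>\<^bsub>M\<^esub> b \<in> A <+>\<^bsub>M\<^esub> B"
  by (auto simp: set_add_def')

lemma set_addE:
  assumes "x \<in> A <+>\<^bsub>M\<^esub> B"
  obtains a b where "a \<in> A" "b \<in> B" "x = a \<oplus>\<^bsub>M\<^esub> b"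
  using assms by (auto simp: set_add_def')

lemma submoduleD:
  assumes "submodule A R M"
  shows "A \<subseteq> carrier M" "\<zero>\<^bsub>M\<^esub> \<in> A"
    "\<And>x y. x \<in> A \<Longrightarrow> y \<in> A \<Longrightarrow> x \<oplus>\<^bsub>M\<^esub> y \<in> A"
    "\<And>x. x \<in> A \<Longrightarrow> \<ominus>\<^bsub>M\<^esub> x \<in> A"
    "\<And>x y. x \<in> A \<Longrightarrow> y \<in> A \<Longrightarrow> x \<ominus>\<^bsub>M\<^esub> y \<in> A"
    "\<And>a x. a \<in> carrier R \<Longrightarrow> x \<in> A \<Longrightarrow> a \<odot>\<^bsub>M\<^esub> x \<in> A"
proof -
  interpret submodule A R M by fact
  show "A \<subseteq> carrier M" "\<zero>\<^bsub>M\<^esub> \<in> A" using subset one_closed by auto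
  show "x \<oplus>\<^bsub>M\<^esub> y \<in> A" if "x \<in> A" "y \<in> A" for x y
    using m_closed that by simp
  show inv: "\<ominus>\<^bsub>M\<^esub> x \<in> A" if "x \<in> A" for x
    using m_inv_closed that by (simp add: a_inv_def)
  show "x \<ominus>\<^bsub>M\<^esub> y \<in> A" if "x \<in> A" "y \<in> A" for x y
    using m_closed that inv by (simp add: a_minus_def)
  show "a \<odot>\<^bsub>M\<^esub> x \<in> A" if "a \<in> carrier R" "x \<in> A" for a x
    using that by simp
qed

context left_module
begin

lemma smult_zero_right [simp]: "a \<in> carrier R \<Longrightarrow> a \<odot>\<^bsub>M\<^esub> \<zero>\<^bsub>M\<^esub> = \<zero>\<^bsub>M\<^esub>"
  using smult_r_distr[of a "\<zero>\<^bsub>M\<^esub>" "\<zero>\<^bsub>M\<^esub>"]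
  by (metis M.add.r_cancel_one M.l_zero M.zero_closed smult_closed)

lemma smult_minus_one: "x \<in> carrier M \<Longrightarrow> (\<ominus> \<one>) \<odot>\<^bsub>M\<^esub> x = \<ominus>\<^bsub>M\<^esub> x"
proof -
  assume x: "x \<in> carrier M"
  have z: "\<zero> \<odot>\<^bsub>M\<^esub> x = \<zero>\<^bsub>M\<^esub>"
    using x smult_l_distr[of "\<zero>" "\<zero>" x]
    by (metis M.add.r_cancel_one R.l_zero R.zero_closed smult_closed)
  have "(\<ominus> \<one>) \<odot>\<^bsub>M\<^esub> x \<oplus>\<^bsub>M\<^esub> x = \<zero>\<^bsub>M\<^esub>"
    using x smult_l_distr[of "\<ominus> \<one>" "\<one>" x] z by (simp add: R.l_neg)
  then show ?thesis using x by (simp add: M.minus_equality)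
qed

text \<open>Closure under negation comes from scalar multiplication by
  \<open>\<ominus> \<one>\<close>.\<close>

lemma submoduleI:
  assumes "A \<subseteq> carrier M" "\<zero>\<^bsub>M\<^esub> \<in> A"
    and "\<And>x y. x \<in> A \<Longrightarrow> y \<in> A \<Longrightarrow> x \<oplus>\<^bsub>M\<^esub> y \<in> A"
    and sm: "\<And>a x. a \<in> carrier R \<Longrightarrow> x \<in> A \<Longrightarrow> a \<odot>\<^bsub>M\<^esub> x \<in> A"
  shows "submodule A R M"
proof -
  have "\<ominus>\<^bsub>M\<^esub> x \<in> A" if "x \<in> A" for x
    using sm[of "\<ominus> \<one>" x] that assms(1) by (auto simp: smult_minus_one)
  then show ?thesis
    using assms by (intro submodule.intro subgroup.intro) (auto simp: submodule_axioms_def a_inv_def)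
qed

lemma submodule_carrier: "submodule (carrier M) R M"
  by (rule submoduleI) auto

lemma submodule_zero: "submodule {\<zero>\<^bsub>M\<^esub>} R M"
  by (rule submoduleI) auto

lemma submodule_Int:
  "submodule A R M \<Longrightarrow> submodule B R M \<Longrightarrow> submodule (A \<inter> B) R M"
  using submoduleD[of A R M] submoduleD[of B R M] by (intro submoduleI) (simp_all, blast)

lemma submodule_set_add:
  assumes A: "submodule A R M" and B: "submodule B R M"
  shows "submodule (A <+>\<^bsub>M\<^esub> B) R M"
proof -
  note A' = submoduleD[OF A] and B' = submoduleD[OF B]
  have subs: "\<And>x. x \<in> A \<Longrightarrow> x \<in> carrier M" "\<And>x. x \<in> B \<Longrightarrow> x \<in> carrier M"
    using A'(1) B'(1) by auto
  show ?thesis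
  proof (rule submoduleI)
    show "A <+>\<^bsub>M\<^esub> B \<subseteq> carrier M" using subs by (auto elim!: set_addE)
    show "\<zero>\<^bsub>M\<^esub> \<in> A <+>\<^bsub>M\<^esub> B" using set_addI[OF A'(2) B'(2), of M] by simp
  next
    fix x y assume "x \<in> A <+>\<^bsub>M\<^esub> B" "y \<in> A <+>\<^bsub>M\<^esub> B"
    then obtain a b c d
      where *: "a \<in> A" "b \<in> B" "c \<in> A" "d \<in> B" "x = a \<oplus>\<^bsub>M\<^esub> b" "y = c \<oplus>\<^bsub>M\<^esub> d"
      by (auto elim!: set_addE)
    have "x \<oplus>\<^bsub>M\<^esub> y = (a \<oplus>\<^bsub>M\<^esub> c) \<oplus>\<^bsub>M\<^esub> (b \<oplus>\<^bsub>M\<^esub> d)"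
      using * subs by (simp add: M.a_ac)
    then show "x \<oplus>\<^bsub>M\<^esub> y \<in> A <+>\<^bsub>M\<^esub> B"
      using set_addI[OF A'(3)[OF *(1,3)] B'(3)[OF *(2,4)], of M] by simp
  next
    fix a x assume a: "a \<in> carrier R" and "x \<in> A <+>\<^bsub>M\<^esub> B"
    then obtain y z where *: "y \<in> A" "z \<in> B" "x = y \<oplus>\<^bsub>M\<^esub> z"
      by (auto elim!: set_addE)
    then have "a \<odot>\<^bsub>M\<^esub> x = a \<odot>\<^bsub>M\<^esub> y \<oplus>\<^bsub>M\<^esub> a \<odot>\<^bsub>M\<^esub> z"
      using subs a by (simp add: smult_r_distr)
    then show "a \<odot>\<^bsub>M\<^esub> x \<in> A <+>\<^bsub>M\<^esub> B"
      using set_addI[OF A'(6)[OF a *(1)] B'(6)[OF a *(2)], of M] by simp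
  qed
qed

lemma submodule_left_module:
  assumes "submodule A R M"
  shows "left_module R (M\<lparr>carrier := A\<rparr>)"
proof -
  note D = submoduleD[OF assms]
  have sub: "\<And>x. x \<in> A \<Longrightarrow> x \<in> carrier M" using D(1) by blast
  have "abelian_group (M\<lparr>carrier := A\<rparr>)"
  proof (rule abelian_groupI)
    fix x assume "x \<in> carrier (M\<lparr>carrier := A\<rparr>)"
    then show "\<exists>y\<in>carrier (M\<lparr>carrier := A\<rparr>). y \<oplus>\<^bsub>M\<lparr>carrier := A\<rparr>\<^esub> x = \<zero>\<^bsub>M\<lparr>carrier := A\<rparr>\<^esub>"
      using D(4) sub by (auto simp: M.l_neg intro!: bexI[of _ "\<ominus>\<^bsub>M\<^esub> x"])
  qed (use D(2,3) sub in \<open>auto simp: M.a_ac\<close>)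
  moreover have "left_module_axioms R (M\<lparr>carrier := A\<rparr>)"
    using D(6) sub
    by (intro left_module_axioms.intro) (simp_all add: smult_l_distr smult_r_distr smult_assoc1)
  ultimately show ?thesis
    using R.ring_axioms by (simp add: left_module_def)
qed

lemma submodule_restrict:
  assumes "submodule A R M" "submodule B R M" "B \<subseteq> A"
  shows "submodule B R (M\<lparr>carrier := A\<rparr>)"
proof -
  interpret A: left_module R "M\<lparr>carrier := A\<rparr>" using assms(1) by (rule submodule_left_module)
  show ?thesis using submoduleD[OF assms(2)] assms(3) by (intro A.submoduleI) auto
qed

text \<open>Factor maps live on a member \<open>B\<close> of a chain, not on all of
  \<open>M\<close>, so the homomorphism rules are derived for \<open>M\<close> with its carrier
  shrunk to \<open>B\<close>.\<close>

lemma lmod_hom_restrictD: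
  assumes B: "submodule B R M" and N: "left_module R N" and p: "p \<in> lmod_hom R (M\<lparr>carrier := B\<rparr>) N"
  shows "\<And>x. x \<in> B \<Longrightarrow> p x \<in> carrier N"
    "\<And>x y. x \<in> B \<Longrightarrow> y \<in> B \<Longrightarrow> p (x \<oplus>\<^bsub>M\<^esub> y) = p x \<oplus>\<^bsub>N\<^esub> p y"
    "\<And>a x. a \<in> carrier R \<Longrightarrow> x \<in> B \<Longrightarrow> p (a \<odot>\<^bsub>M\<^esub> x) = a \<odot>\<^bsub>N\<^esub> p x"
    "p \<zero>\<^bsub>M\<^esub> = \<zero>\<^bsub>N\<^esub>"
    "\<And>x y. x \<in> B \<Longrightarrow> y \<in> B \<Longrightarrow> p (x \<ominus>\<^bsub>M\<^esub> y) = p x \<ominus>\<^bsub>N\<^esub> p y"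
proof -
  interpret N: left_module R N by fact
  note D = submoduleD[OF B]
  show cl: "p x \<in> carrier N" if "x \<in> B" for x
    using p that by (auto simp: lmod_hom_def)
  show add: "p (x \<oplus>\<^bsub>M\<^esub> y) = p x \<oplus>\<^bsub>N\<^esub> p y" if "x \<in> B" "y \<in> B" for x y
    using p that by (auto simp: lmod_hom_def)
  show "p (a \<odot>\<^bsub>M\<^esub> x) = a \<odot>\<^bsub>N\<^esub> p x" if "a \<in> carrier R" "x \<in> B" for a x
    using p that by (auto simp: lmod_hom_def)
  show z: "p \<zero>\<^bsub>M\<^esub> = \<zero>\<^bsub>N\<^esub>"
    using add[of "\<zero>\<^bsub>M\<^esub>" "\<zero>\<^bsub>M\<^esub>"] D(2) cl[of "\<zero>\<^bsub>M\<^esub>"] by simp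
  show "p (x \<ominus>\<^bsub>M\<^esub> y) = p x \<ominus>\<^bsub>N\<^esub> p y" if x: "x \<in> B" and y: "y \<in> B" for x y
  proof -
    have yM: "y \<in> carrier M" using y D(1) by blast
    have "p (\<ominus>\<^bsub>M\<^esub> y) \<oplus>\<^bsub>N\<^esub> p y = \<zero>\<^bsub>N\<^esub>"
      using add[of "\<ominus>\<^bsub>M\<^esub> y" y] y yM D(4) z by (simp add: M.l_neg)
    then have "p (\<ominus>\<^bsub>M\<^esub> y) = \<ominus>\<^bsub>N\<^esub> p y"
      using cl y D(4) by (simp add: N.M.minus_equality)
    then show ?thesis using add[of x "\<ominus>\<^bsub>M\<^esub> y"] x y D(4) by (simp add: a_minus_def)
  qed
qed

lemma lmod_homD:
  assumes N: "left_module R N" and p: "p \<in> lmod_hom R M N"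
  shows "\<And>x. x \<in> carrier M \<Longrightarrow> p x \<in> carrier N"
    "\<And>x y. x \<in> carrier M \<Longrightarrow> y \<in> carrier M \<Longrightarrow> p (x \<oplus>\<^bsub>M\<^esub> y) = p x \<oplus>\<^bsub>N\<^esub> p y"
    "\<And>a x. a \<in> carrier R \<Longrightarrow> x \<in> carrier M \<Longrightarrow> p (a \<odot>\<^bsub>M\<^esub> x) = a \<odot>\<^bsub>N\<^esub> p x"
    "p \<zero>\<^bsub>M\<^esub> = \<zero>\<^bsub>N\<^esub>"
    "\<And>x y. x \<in> carrier M \<Longrightarrow> y \<in> carrier M \<Longrightarrow> p (x \<ominus>\<^bsub>M\<^esub> y) = p x \<ominus>\<^bsub>N\<^esub> p y"
proof -
  have p': "p \<in> lmod_hom R (M\<lparr>carrier := carrier M\<rparr>) N" using p by simp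
  note * = lmod_hom_restrictD[OF submodule_carrier N p']
  show "\<And>x. x \<in> carrier M \<Longrightarrow> p x \<in> carrier N"
    "\<And>x y. x \<in> carrier M \<Longrightarrow> y \<in> carrier M \<Longrightarrow> p (x \<oplus>\<^bsub>M\<^esub> y) = p x \<oplus>\<^bsub>N\<^esub> p y"
    "\<And>a x. a \<in> carrier R \<Longrightarrow> x \<in> carrier M \<Longrightarrow> p (a \<odot>\<^bsub>M\<^esub> x) = a \<odot>\<^bsub>N\<^esub> p x"
    "p \<zero>\<^bsub>M\<^esub> = \<zero>\<^bsub>N\<^esub>"
    "\<And>x y. x \<in> carrier M \<Longrightarrow> y \<in> carrier M \<Longrightarrow> p (x \<ominus>\<^bsub>M\<^esub> y) = p x \<ominus>\<^bsub>N\<^esub> p y"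
    by (fact *)+
qed

end

text \<open>\<open>B / A\<close> is isomorphic to \<open>X\<close>, expressed without cosets by a
  surjection from \<open>B\<close> onto \<open>X\<close> with kernel \<open>A\<close>. In this form
  a factor is easily restricted to a submodule or transported along a homomorphism.\<close>

definition factor_by ::
  "('a, 'r) ring_scheme \<Rightarrow> ('a, 'b) module \<Rightarrow> 'b set \<Rightarrow> 'b set \<Rightarrow> ('a, 'x) module \<Rightarrow> bool" where
  "factor_by R M A B X \<longleftrightarrow> (\<exists>p\<in>lmod_hom R (M\<lparr>carrier := B\<rparr>) X.
     p ` B = carrier X \<and> (\<forall>x\<in>B. p x = \<zero>\<^bsub>X\<^esub> \<longleftrightarrow> x \<in> A))"

context left_module
begin

lemma a_minus_eq_zero_iff:
  "x \<in> carrier M \<Longrightarrow> y \<in> carrier M \<Longrightarrow> x \<ominus>\<^bsub>M\<^esub> y = \<zero>\<^bsub>M\<^esub> \<longleftrightarrow> x = y"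
  by (metis M.add.inv_closed M.minus_equality M.minus_minus M.r_neg a_minus_def)

text \<open>The first isomorphism theorem: an isomorphism from the quotient is composed with the
  projection, and conversely a surjection with kernel \<open>A\<close> is constant on
  cosets.\<close>

lemma isomorphic_quot_iff_factor_by_carrier:
  assumes A: "submodule A R M" and X: "left_module R X"
  shows "lmod_isomorphic R (lmod_quot M A) X \<longleftrightarrow> factor_by R M A (carrier M) X"
proof -
  interpret X: left_module R X by fact
  interpret A: abelian_subgroup A M
    using A by (intro abelian_subgroupI3 additive_subgroup.intro)
      (auto simp: submodule_def M.abelian_group_axioms)
  note D = submoduleD[OF A]
  let ?Q = "lmod_quot M A"
  have cQ: "carrier ?Q = {A +>\<^bsub>M\<^esub> x | x. x \<in> carrier M}"
    by (auto simp: lmod_quot_def A_RCOSETS_def')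
  have mem: "y \<in> A +>\<^bsub>M\<^esub> x \<longleftrightarrow> y \<ominus>\<^bsub>M\<^esub> x \<in> A" if "x \<in> carrier M" "y \<in> carrier M" for x y
    using A.a_rcos_module[OF that] by (simp add: a_minus_def)
  have memc: "y \<in> carrier M" if "y \<in> A +>\<^bsub>M\<^esub> x" "x \<in> carrier M" for x y
    using that A.a_elemrcos_carrier by blast
  have eq: "A +>\<^bsub>M\<^esub> y = A +>\<^bsub>M\<^esub> x" if "y \<in> A +>\<^bsub>M\<^esub> x" "x \<in> carrier M" for x y
    using that A.a_repr_independence' memc by metis
  have self: "x \<in> A +>\<^bsub>M\<^esub> x" if "x \<in> carrier M" for x
    using that by (rule A.a_rcos_self)
  have zQ: "A +>\<^bsub>M\<^esub> x = A \<longleftrightarrow> x \<in> A" if "x \<in> carrier M" for x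
    using that self[OF that] A.a_rcos_const by auto
  have add: "(A +>\<^bsub>M\<^esub> x) \<oplus>\<^bsub>?Q\<^esub> (A +>\<^bsub>M\<^esub> y) = A +>\<^bsub>M\<^esub> (x \<oplus>\<^bsub>M\<^esub> y)"
    if "x \<in> carrier M" "y \<in> carrier M" for x y
    using A.a_rcos_sum[OF that] by (simp add: lmod_quot_def)
  have sm: "a \<odot>\<^bsub>?Q\<^esub> (A +>\<^bsub>M\<^esub> x) = A +>\<^bsub>M\<^esub> (a \<odot>\<^bsub>M\<^esub> x)" if a: "a \<in> carrier R" and x: "x \<in> carrier M" for a x
  proof -
    \<comment> \<open>Scalar multiplication on \<open>lmod_quot\<close> is a union over all
      representatives \<open>c\<close>; the cosets in this union all coincide.\<close>
    have "A +>\<^bsub>M\<^esub> (a \<odot>\<^bsub>M\<^esub> c) = A +>\<^bsub>M\<^esub> (a \<odot>\<^bsub>M\<^esub> x)" if c: "c \<in> A +>\<^bsub>M\<^esub> x" for c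
    proof (rule eq)
      have cM: "c \<in> carrier M" using c x memc by blast
      have "c \<ominus>\<^bsub>M\<^esub> x \<in> A" using c mem[OF x cM] by simp
      then have "a \<odot>\<^bsub>M\<^esub> (c \<ominus>\<^bsub>M\<^esub> x) \<in> A" using D(6) a by blast
      moreover have "a \<odot>\<^bsub>M\<^esub> (\<ominus>\<^bsub>M\<^esub> x) = \<ominus>\<^bsub>M\<^esub> (a \<odot>\<^bsub>M\<^esub> x)"
        using smult_r_distr[of a "\<ominus>\<^bsub>M\<^esub> x" x] a x M.l_neg[of x]
        by (intro M.minus_equality[symmetric]) auto
      ultimately show "a \<odot>\<^bsub>M\<^esub> c \<in> A +>\<^bsub>M\<^esub> (a \<odot>\<^bsub>M\<^esub> x)"
        using a x cM mem by (simp add: a_minus_def smult_r_distr)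
    qed (use a x in auto)
    moreover have "A +>\<^bsub>M\<^esub> x \<noteq> {}" using self[OF x] by blast
    ultimately show ?thesis unfolding lmod_quot_def by auto
  qed
  show ?thesis
  proof
    assume "lmod_isomorphic R ?Q X"
    then obtain f where f: "f \<in> lmod_hom R ?Q X" and bij: "bij_betw f (carrier ?Q) (carrier X)"
      by (auto simp: lmod_isomorphic_def)
    let ?p = "\<lambda>x. f (A +>\<^bsub>M\<^esub> x)"
    have cl: "A +>\<^bsub>M\<^esub> x \<in> carrier ?Q" if "x \<in> carrier M" for x using that cQ by blast
    have fcl: "f C \<in> carrier X" if "C \<in> carrier ?Q" for C using that f by (auto simp: lmod_hom_def)
    have p: "?p \<in> lmod_hom R M X"
      using f cl by (auto simp: lmod_hom_def simp flip: add sm)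
    have p0: "?p \<zero>\<^bsub>M\<^esub> = \<zero>\<^bsub>X\<^esub>" using lmod_homD(4)[OF X p] .
    have "?p x = \<zero>\<^bsub>X\<^esub> \<longleftrightarrow> x \<in> A" if x: "x \<in> carrier M" for x
    proof -
      have "?p x = ?p \<zero>\<^bsub>M\<^esub> \<longleftrightarrow> A +>\<^bsub>M\<^esub> x = A +>\<^bsub>M\<^esub> \<zero>\<^bsub>M\<^esub>"
        using bij cl x by (intro inj_on_eq_iff[of f "carrier ?Q"]) (auto simp: bij_betw_def)
      then show ?thesis using p0 zQ[OF x] zQ[of "\<zero>\<^bsub>M\<^esub>"] D(2) by auto
    qed
    moreover have "?p ` carrier M = f ` carrier ?Q" by (auto simp: cQ)
    then have "?p ` carrier M = carrier X" using bij by (simp add: bij_betw_def)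
    ultimately show "factor_by R M A (carrier M) X"
      using p unfolding factor_by_def by (intro bexI[of _ ?p]) auto
  next
    assume "factor_by R M A (carrier M) X"
    then obtain p where p: "p \<in> lmod_hom R M X" and onto: "p ` carrier M = carrier X"
      and ker: "\<And>x. x \<in> carrier M \<Longrightarrow> p x = \<zero>\<^bsub>X\<^esub> \<longleftrightarrow> x \<in> A"
      by (auto simp: factor_by_def)
    note p' = lmod_homD[OF X p]
    \<comment> \<open>Any representative serves: two of them differ by an element of
      \<open>A\<close>, which \<open>p\<close> kills.\<close>
    let ?f = "\<lambda>C. p (SOME c. c \<in> C)"
    have f: "?f (A +>\<^bsub>M\<^esub> x) = p x" if x: "x \<in> carrier M" for x
    proof -
      let ?c = "SOME c. c \<in> A +>\<^bsub>M\<^esub> x"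
      have c: "?c \<in> A +>\<^bsub>M\<^esub> x" using self[OF x] by (rule someI)
      then have "?c \<in> carrier M" "?c \<ominus>\<^bsub>M\<^esub> x \<in> A" using memc mem x by blast+
      then show ?thesis using ker[of "?c \<ominus>\<^bsub>M\<^esub> x"] p' x X.a_minus_eq_zero_iff by simp
    qed
    have "?f \<in> lmod_hom R ?Q X"
      unfolding lmod_hom_def cQ using p' by (auto simp: f add sm)
    moreover have "bij_betw ?f (carrier ?Q) (carrier X)"
      unfolding bij_betw_def
    proof
      show "inj_on ?f (carrier ?Q)"
      proof (rule inj_onI)
        fix C E assume "C \<in> carrier ?Q" "E \<in> carrier ?Q" and e: "?f C = ?f E"
        then obtain x y where xy: "x \<in> carrier M" "y \<in> carrier M" "C = A +>\<^bsub>M\<^esub> x" "E = A +>\<^bsub>M\<^esub> y"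
          using cQ by auto
        then have "p x = p y" using e f by simp
        then have "x \<ominus>\<^bsub>M\<^esub> y \<in> A" using ker[of "x \<ominus>\<^bsub>M\<^esub> y"] p' xy X.a_minus_eq_zero_iff by simp
        then show "C = E" using xy mem eq by blast
      qed
      have "?f ` carrier ?Q = p ` carrier M"
        unfolding cQ using f by (force simp: image_iff)
      then show "?f ` carrier ?Q = carrier X" using onto by simp
    qed
    ultimately show "lmod_isomorphic R ?Q X" unfolding lmod_isomorphic_def by blast
  qed
qed

lemma isomorphic_quot_iff_factor_by:
  assumes "submodule A R M" "submodule B R M" "A \<subseteq> B" "left_module R X"
  shows "lmod_isomorphic R (lmod_quot (M\<lparr>carrier := B\<rparr>) A) X \<longleftrightarrow> factor_by R M A B X"
proof -
  interpret B: left_module R "M\<lparr>carrier := B\<rparr>" using assms(2) by (rule submodule_left_module)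
  show ?thesis
    using B.isomorphic_quot_iff_factor_by_carrier[OF submodule_restrict[OF assms(2,1,3)] assms(4)]
    by (simp add: factor_by_def)
qed

end

subsection \<open>Bricks\<close>

lemma (in left_module) a_minus_add_cancel:
  "x \<in> carrier M \<Longrightarrow> y \<in> carrier M \<Longrightarrow> (x \<ominus>\<^bsub>M\<^esub> y) \<oplus>\<^bsub>M\<^esub> y = x"
  by (simp add: a_minus_def M.a_assoc M.l_neg)

text \<open>\<open>T\<close> is the image of the standard basis of \<open>R^n\<close>. Generation is
  phrased through submodules containing \<open>T\<close>, because it will be applied to
  preimages.\<close>

lemma finitely_presented_generators:
  assumes "finitely_presented R X"
  obtains T where "finite T" "T \<subseteq> carrier X"
    "\<And>H. submodule H R X \<Longrightarrow> T \<subseteq> H \<Longrightarrow> carrier X \<subseteq> H"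
proof -
  obtain n g where X: "left_module R X" and g: "g \<in> lmod_hom R (free_lmod R n) X"
    and onto: "g ` carrier (free_lmod R n) = carrier X"
    using assms by (auto simp: finitely_presented_def)
  interpret X: left_module R X by fact
  let ?F = "free_lmod R n"
  define e where "e k = (\<lambda>i\<in>{..<n}. if i = k then \<one>\<^bsub>R\<^esub> else \<zero>\<^bsub>R\<^esub>)" for k :: nat
  have e: "e k \<in> carrier ?F" for k by (auto simp: e_def free_lmod_def)
  have gcl: "g x \<in> carrier X" if "x \<in> carrier ?F" for x using g that by (auto simp: lmod_hom_def)
  have gadd: "g (x \<oplus>\<^bsub>?F\<^esub> y) = g x \<oplus>\<^bsub>X\<^esub> g y" if "x \<in> carrier ?F" "y \<in> carrier ?F" for x y
    using g that by (auto simp: lmod_hom_def)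
  have gsm: "g (a \<odot>\<^bsub>?F\<^esub> x) = a \<odot>\<^bsub>X\<^esub> g x" if "a \<in> carrier R" "x \<in> carrier ?F" for a x
    using g that by (auto simp: lmod_hom_def)
  have z: "\<zero>\<^bsub>?F\<^esub> \<in> carrier ?F" "\<zero>\<^bsub>?F\<^esub> \<oplus>\<^bsub>?F\<^esub> \<zero>\<^bsub>?F\<^esub> = \<zero>\<^bsub>?F\<^esub>"
    by (auto simp: free_lmod_def)
  have gz: "g \<zero>\<^bsub>?F\<^esub> = \<zero>\<^bsub>X\<^esub>" using gadd[OF z(1) z(1)] gcl[OF z(1)] z(2) by simp
  let ?T = "g ` e ` {..<n}"
  have gen: "carrier X \<subseteq> H" if H: "submodule H R X" and T: "?T \<subseteq> H" for H
  proof -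
    note D = submoduleD[OF H]
    \<comment> \<open>Induction on the number \<open>m\<close> of leading coordinates that may be
      nonzero; each step splits off the coordinate with index \<open>m\<close>.\<close>
    have "g x \<in> H" if "x \<in> carrier ?F" "\<forall>i. m \<le> i \<longrightarrow> i < n \<longrightarrow> x i = \<zero>\<^bsub>R\<^esub>" "m \<le> n" for m x
      using that
    proof (induction m arbitrary: x)
      case 0
      then have "x = \<zero>\<^bsub>?F\<^esub>" by (auto simp: free_lmod_def PiE_def extensional_def)
      then show ?case using gz D by simp
    next
      case (Suc m)
      have xm: "x m \<in> carrier R" using Suc.prems by (auto simp: free_lmod_def)
      let ?y = "x(m := \<zero>\<^bsub>R\<^esub>)"
      have y: "?y \<in> carrier ?F" using Suc.prems by (auto simp: free_lmod_def PiE_def extensional_def)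
      have ae: "x m \<odot>\<^bsub>?F\<^esub> e m \<in> carrier ?F"
        using xm by (auto simp: free_lmod_def e_def)
      have "x = ?y \<oplus>\<^bsub>?F\<^esub> (x m \<odot>\<^bsub>?F\<^esub> e m)"
      proof
        fix i show "x i = (?y \<oplus>\<^bsub>?F\<^esub> (x m \<odot>\<^bsub>?F\<^esub> e m)) i"
          using Suc.prems(1) xm by (cases "i < n") (auto simp: free_lmod_def e_def PiE_def extensional_def Pi_def)
      qed
      then have gx: "g x = g ?y \<oplus>\<^bsub>X\<^esub> x m \<odot>\<^bsub>X\<^esub> g (e m)"
        using gadd[OF y ae] gsm[OF xm e] by simp
      have "g ?y \<in> H" using Suc.prems y 
        by (intro Suc.IH) (auto simp del: fun_upd_apply, auto)
      moreover have "g (e m) \<in> H" using T Suc.prems by auto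
      ultimately show ?case using gx D xm by simp
    qed
    from this[of _ n] show ?thesis unfolding onto[symmetric] by auto
  qed
  have "finite ?T" "?T \<subseteq> carrier X" using e gcl by auto
  then show thesis using that gen by blast
qed

text \<open>\<open>T\<close> consists of lifts of generators of \<open>X\<close>. If
  \<open>H\<close> contains \<open>T\<close>, then \<open>p\<close> maps \<open>H\<close> onto
  \<open>X\<close>, so each element of \<open>B\<close> differs from one of \<open>H\<close> by an
  element of the kernel \<open>A\<close>, which lies in \<open>H\<close>.\<close>

lemma factor_by_generators:
  assumes M: "left_module R M" and A: "submodule A R M" and B: "submodule B R M"
    and X: "finitely_presented R X" and f: "factor_by R M A B X"
  obtains T where "finite T" "T \<subseteq> B"
    "\<And>H. submodule H R M \<Longrightarrow> A \<subseteq> H \<Longrightarrow> H \<subseteq> B \<Longrightarrow> T \<subseteq> H \<Longrightarrow> B \<subseteq> H"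
proof -
  interpret M: left_module R M by fact
  interpret X: left_module R X using X by (simp add: finitely_presented_def)
  obtain T' where T': "finite T'" "T' \<subseteq> carrier X"
    "\<And>H. submodule H R X \<Longrightarrow> T' \<subseteq> H \<Longrightarrow> carrier X \<subseteq> H"
    using finitely_presented_generators[OF X] by blast
  obtain p where p: "p \<in> lmod_hom R (M\<lparr>carrier := B\<rparr>) X" and onto: "p ` B = carrier X"
    and ker: "\<And>x. x \<in> B \<Longrightarrow> p x = \<zero>\<^bsub>X\<^esub> \<longleftrightarrow> x \<in> A"
    using f by (auto simp: factor_by_def)
  note p' = M.lmod_hom_restrictD[OF B X.left_module_axioms p]
  obtain T where T: "T \<subseteq> B" "finite T" "T' = p ` T"
    using finite_subset_image[OF T'(1)] T'(2) onto by metis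
  have gen: "B \<subseteq> H" if H: "submodule H R M" "A \<subseteq> H" "H \<subseteq> B" "T \<subseteq> H" for H
  proof
    note D = submoduleD[OF H(1)]
    have hB: "\<And>x. x \<in> H \<Longrightarrow> x \<in> B" using H by blast
    have "submodule (p ` H) R X"
    proof (rule X.submoduleI)
      show "p ` H \<subseteq> carrier X" using hB p'(1) by auto
      show "\<zero>\<^bsub>X\<^esub> \<in> p ` H" using p'(4) D(2) by (metis imageI)
    next
      fix x y assume "x \<in> p ` H" "y \<in> p ` H"
      then obtain u v where "u \<in> H" "v \<in> H" "x = p u" "y = p v" by blast
      then show "x \<oplus>\<^bsub>X\<^esub> y \<in> p ` H" using p'(2) hB D(3) by (metis imageI)
    next
      fix a x assume "a \<in> carrier R" "x \<in> p ` H"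
      then obtain u where "a \<in> carrier R" "u \<in> H" "x = p u" by blast
      then show "a \<odot>\<^bsub>X\<^esub> x \<in> p ` H" using p'(3) hB D(6) by (metis imageI)
    qed
    moreover have "T' \<subseteq> p ` H" using T H by blast
    ultimately have *: "carrier X \<subseteq> p ` H" by (rule T'(3))
    fix x assume x: "x \<in> B"
    then have "p x \<in> p ` H" using * p'(1) by blast
    then obtain y where y: "y \<in> H" "p x = p y" by blast
    have yB: "y \<in> B" using y hB by blast
    have "x \<ominus>\<^bsub>M\<^esub> y \<in> B" using submoduleD(5)[OF B x yB] .
    moreover have "p (x \<ominus>\<^bsub>M\<^esub> y) = \<zero>\<^bsub>X\<^esub>"
      using p'(5)[OF x yB] y(2) X.a_minus_eq_zero_iff p'(1)[OF yB] by simp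
    ultimately have "x \<ominus>\<^bsub>M\<^esub> y \<in> H" using ker H(2) by blast
    then have "(x \<ominus>\<^bsub>M\<^esub> y) \<oplus>\<^bsub>M\<^esub> y \<in> H" using y(1) by (rule D(3))
    moreover have "(x \<ominus>\<^bsub>M\<^esub> y) \<oplus>\<^bsub>M\<^esub> y = x"
      using x yB submoduleD(1)[OF B] by (intro M.a_minus_add_cancel) auto
    ultimately show "x \<in> H" by simp
  qed
  show thesis using that[OF T(2,1)] gen by blast
qed

text \<open>Schur's lemma for semibricks: between distinct members all maps vanish, and a nonzero
  endomorphism is a unit of a division ring.\<close>

lemma semibrick_hom_cases:
  assumes S: "semibrick R \<X>" and A: "A \<in> \<X>" and B: "B \<in> \<X>" and f: "f \<in> lmod_hom R A B"
  shows "(\<forall>x\<in>carrier A. f x = \<zero>\<^bsub>B\<^esub>) \<or> bij_betw f (carrier A) (carrier B)"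
proof (cases "A = B")
  case False
  then show ?thesis using assms by (auto simp: semibrick_def)
next
  case True
  let ?E = "lmod_End R A"
  \<comment> \<open>Elements of \<open>lmod_End\<close> are extensional, so \<open>f\<close> itself
    need not be one.\<close>
  let ?f = "restrict f (carrier A)"
  have dr: "division_ring ?E" and lm: "left_module R A"
    using S A by (auto simp: semibrick_def brick_def)
  interpret A: left_module R A by fact
  have fE: "?f \<in> carrier ?E"
    using f unfolding True[symmetric] by (auto simp: lmod_End_def lmod_hom_def)
  show ?thesis
  proof (cases "?f = \<zero>\<^bsub>?E\<^esub>")
    case t: True
    have "f x = \<zero>\<^bsub>B\<^esub>" if "x \<in> carrier A" for x
      using fun_cong[OF t, of x] that True by (simp add: lmod_End_def)
    then show ?thesis by blast
  next
    case False
    then have "?f \<in> Units ?E" using dr fE by (simp add: division_ring_def)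
    then obtain g where g: "g \<in> carrier ?E" "g \<otimes>\<^bsub>?E\<^esub> ?f = \<one>\<^bsub>?E\<^esub>" "?f \<otimes>\<^bsub>?E\<^esub> g = \<one>\<^bsub>?E\<^esub>"
      by (auto simp: Units_def)
    have gc: "g x \<in> carrier A" if "x \<in> carrier A" for x
      using g(1) that by (auto simp: lmod_End_def lmod_hom_def)
    have fc: "f x \<in> carrier A" if "x \<in> carrier A" for x
      using f that True by (auto simp: lmod_hom_def)
    have gf: "g (f x) = x" if "x \<in> carrier A" for x
      using fun_cong[OF g(2), of x] that by (simp add: lmod_End_def compose_def)
    have fg: "f (g x) = x" if "x \<in> carrier A" for x
      using fun_cong[OF g(3), of x] that gc[OF that] by (simp add: lmod_End_def compose_def)
    have "bij_betw f (carrier A) (carrier B)"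
      using gc fc gf fg True by (intro bij_betw_byWitness[of _ g]) auto
    then show ?thesis by blast
  qed
qed

lemma semibrickD:
  assumes "semibrick R \<X>" "X \<in> \<X>"
  shows "left_module R X" "finitely_presented R X"
  using assms by (simp_all add: semibrick_def brick_def)

subsection \<open>Filtrations as chains of submodules\<close>

text \<open>At a successor this is the immediate predecessor, at a limit it is \<open>B\<close>
  itself. At the zero submodule, the least member of a filtration chain, it is the empty set, hence
  no submodule.\<close>

definition below :: "'b set set \<Rightarrow> 'b set \<Rightarrow> 'b set" where
  "below C B = \<Union>{A \<in> C. A \<subset> B}"

text \<open>The second clause makes inclusion a well-order on \<open>C\<close>, in particular a
  total one. The disjuncts of the last clause correspond to the zero, limit and successor
  members.\<close>

definition filt_chain ::
  "('a, 'r) ring_scheme \<Rightarrow> ('a, 'x) module set \<Rightarrow> ('a, 'b) module \<Rightarrow> 'b set set \<Rightarrow> bool" where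
  "filt_chain R \<X> M C \<longleftrightarrow>
    (\<forall>A\<in>C. submodule A R M) \<and>
    (\<forall>D\<subseteq>C. D \<noteq> {} \<longrightarrow> (\<exists>A\<in>D. \<forall>B\<in>D. A \<subseteq> B)) \<and>
    {\<zero>\<^bsub>M\<^esub>} \<in> C \<and> carrier M \<in> C \<and>
    (\<forall>B\<in>C. B = {\<zero>\<^bsub>M\<^esub>} \<or> below C B = B \<or>
       below C B \<in> C \<and> (\<exists>X\<in>\<X>. factor_by R M (below C B) B X))"

lemma filt_chainD:
  assumes "filt_chain R \<X> M C"
  shows "\<And>A. A \<in> C \<Longrightarrow> submodule A R M"
    "\<And>D. D \<subseteq> C \<Longrightarrow> D \<noteq> {} \<Longrightarrow> \<exists>A\<in>D. \<forall>B\<in>D. A \<subseteq> B"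
    "{\<zero>\<^bsub>M\<^esub>} \<in> C" "carrier M \<in> C"
    "\<And>B. B \<in> C \<Longrightarrow> B = {\<zero>\<^bsub>M\<^esub>} \<or> below C B = B \<or>
       below C B \<in> C \<and> (\<exists>X\<in>\<X>. factor_by R M (below C B) B X)"
    "\<And>A B. A \<in> C \<Longrightarrow> B \<in> C \<Longrightarrow> A \<subseteq> B \<or> B \<subseteq> A"
proof -
  show least: "\<exists>A\<in>D. \<forall>B\<in>D. A \<subseteq> B" if "D \<subseteq> C" "D \<noteq> {}" for D
    using assms that by (simp add: filt_chain_def)
  show "A \<subseteq> B \<or> B \<subseteq> A" if "A \<in> C" "B \<in> C" for A B
    using least[of "{A, B}"] that by auto
qed (use assms in \<open>auto simp: filt_chain_def\<close>)

lemma filt_chain_induct [consumes 2, case_names less]: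
  assumes C: "filt_chain R \<X> M C" and B: "B \<in> C"
    and step: "\<And>B. B \<in> C \<Longrightarrow> (\<And>A. A \<in> C \<Longrightarrow> A \<subset> B \<Longrightarrow> P A) \<Longrightarrow> P B"
  shows "P B"
proof (rule ccontr)
  assume "\<not> P B"
  then obtain A where A: "A \<in> C" "\<not> P A" "\<forall>A'\<in>{A\<in>C. \<not> P A}. A \<subseteq> A'"
    using filt_chainD(2)[OF C, of "{A \<in> C. \<not> P A}"] B by auto
  then have "P A" by (intro step[of A]) blast+
  with A show False by blast
qed

lemma below_subset: "below C B \<subseteq> B"
  by (auto simp: below_def)

section \<open>Passage between indexed filtrations and chains ordered by inclusion\<close>

definition incl_on :: "'b set set \<Rightarrow> 'b set rel" where
  "incl_on C = {(A, B). A \<in> C \<and> B \<in> C \<and> A \<subseteq> B}"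

lemma incl_on_simps:
  "Field (incl_on C) = C"
  "B \<in> C \<Longrightarrow> under (incl_on C) B = {A \<in> C. A \<subseteq> B}"
  "B \<in> C \<Longrightarrow> underS (incl_on C) B = {A \<in> C. A \<subset> B}"
  by (auto simp: incl_on_def Field_def under_def underS_def)

lemma Well_order_incl_on:
  assumes "\<And>D. D \<subseteq> C \<Longrightarrow> D \<noteq> {} \<Longrightarrow> \<exists>A\<in>D. \<forall>B\<in>D. A \<subseteq> B"
  shows "Well_order (incl_on C)"
proof -
  have cmp: "A \<subseteq> B \<or> B \<subseteq> A" if "A \<in> C" "B \<in> C" for A B
    using assms[of "{A, B}"] that by auto
  have lin: "Linear_order (incl_on C)"
    unfolding linear_order_on_def partial_order_on_def preorder_on_def incl_on_simps
  proof (intro conjI)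
    show "total_on C (incl_on C)" using cmp by (auto simp: total_on_def incl_on_def)
  qed (auto simp: incl_on_def refl_on_def antisym_def intro!: transI)
  show ?thesis
    unfolding Linear_order_Well_order_iff[OF lin]
    unfolding incl_on_simps
  proof (intro allI impI)
    fix D assume D: "D \<subseteq> C" "D \<noteq> {}"
    then obtain A where "A \<in> D" "\<forall>B\<in>D. A \<subseteq> B" using assms by blast
    then show "\<exists>A\<in>D. \<forall>B\<in>D. (A, B) \<in> incl_on C" 
      using D by (intro bexI[of _ A]) (auto simp: incl_on_def)
  qed
qed

text \<open>Passing from a family to its range removes repetitions, so trivial steps are harmless.\<close>

lemma filt_chain_range:
  assumes wo: "Well_order r"
    and sub: "\<And>i. i \<in> Field r \<Longrightarrow> submodule (S i) R M"
    and mono: "\<And>i j. (i, j) \<in> r \<Longrightarrow> S i \<subseteq> S j"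
    and zero: "{\<zero>\<^bsub>M\<^esub>} \<in> S ` Field r" and top: "carrier M \<in> S ` Field r"
    and step: "\<And>j. j \<in> Field r \<Longrightarrow> S j = {\<zero>\<^bsub>M\<^esub>} \<or> S j = (\<Union>i\<in>underS r j. S i) \<or>
      (\<exists>i\<in>underS r j. (\<forall>k\<in>underS r j. S k \<subseteq> S i) \<and>
        (S j = S i \<or> (\<exists>X\<in>\<X>. factor_by R M (S i) (S j) X)))"
  shows "filt_chain R \<X> M (S ` Field r)"
proof -
  interpret r: wo_rel r by (simp add: wo wo_rel.intro)
  have least: "\<exists>i\<in>I. \<forall>j\<in>I. (i, j) \<in> r" if "I \<subseteq> Field r" "I \<noteq> {}" for I
    using that Linear_order_Well_order_iff[of r] wo r.LIN by blast
  show ?thesis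
    unfolding filt_chain_def
  proof (intro conjI ballI allI impI)
    fix D assume D: "D \<subseteq> S ` Field r" "D \<noteq> {}"
    let ?I = "{i \<in> Field r. S i \<in> D}"
    have "?I \<noteq> {}" using D by blast
    then obtain i where i: "i \<in> ?I" "\<forall>j\<in>?I. (i, j) \<in> r" using least[of ?I] by blast
    have "S i \<subseteq> B" if B: "B \<in> D" for B
    proof -
      obtain k where k: "k \<in> Field r" "B = S k" using D(1) B by auto
      then have "(i, k) \<in> r" using i(2) that by simp
      then show ?thesis using mono k(2) by simp
    qed
    then show "\<exists>A\<in>D. \<forall>B\<in>D. A \<subseteq> B" using i(1) by blast
  next
    fix B assume B: "B \<in> S ` Field r"
    \<comment> \<open>With \<open>j\<close> the least index at which the value \<open>B\<close> is
      reached, all earlier indices have strictly smaller values, so \<open>below\<close> can be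
      computed from the predecessors of \<open>j\<close>.\<close>
    let ?I = "{i \<in> Field r. S i = B}"
    have "?I \<noteq> {}" using B by blast
    then obtain j where j: "j \<in> ?I" "\<forall>k\<in>?I. (j, k) \<in> r" using least[of ?I] by blast
    have strict: "S k \<subset> B" if "k \<in> underS r j" for k
    proof -
      have k: "k \<noteq> j" "(k, j) \<in> r" using that by (auto simp: underS_def)
      then have "k \<in> Field r" by (auto simp: Field_def)
      then have "S k \<noteq> B" using j(2) k r.ANTISYM by (auto dest: antisymD)
      then show ?thesis using mono[OF k(2)] j(1) by blast
    qed
    have "{A \<in> S ` Field r. A \<subset> B} = S ` underS r j"
    proof (intro equalityI subsetI)
      fix A assume "A \<in> {A \<in> S ` Field r. A \<subset> B}"
      then obtain k where k: "k \<in> Field r" "A = S k" "S k \<subset> B" by blast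
      then have "(j, k) \<notin> r" using mono[of j k] j(1) by blast
      then have "(k, j) \<in> r" "k \<noteq> j" using k(1,3) j(1) r.TOTALS by blast+
      then show "A \<in> S ` underS r j" using k by (auto simp: underS_def)
    next
      fix A assume "A \<in> S ` underS r j"
      then obtain k where k: "k \<in> underS r j" "A = S k" by blast
      then have "k \<in> Field r" by (auto simp: underS_def Field_def)
      then show "A \<in> {A \<in> S ` Field r. A \<subset> B}" using k strict by blast
    qed
    then have bel: "below (S ` Field r) B = (\<Union>i\<in>underS r j. S i)" by (simp add: below_def)
    have Sj: "S j = B" and jF: "j \<in> Field r" using j(1) by auto
    from step[OF jF, unfolded Sj]
    show "B = {\<zero>\<^bsub>M\<^esub>} \<or> below (S ` Field r) B = B \<or>
       below (S ` Field r) B \<in> S ` Field r \<and> (\<exists>X\<in>\<X>. factor_by R M (below (S ` Field r) B) B X)"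
    proof (elim disjE bexE conjE)
      \<comment> \<open>A trivial step cannot occur at the first index with value
        \<open>B\<close>.\<close>
      fix i assume "i \<in> underS r j" "B = S i"
      then show ?thesis using strict by blast
    next
      fix i X assume i: "i \<in> underS r j" "\<forall>k\<in>underS r j. S k \<subseteq> S i"
        and X: "X \<in> \<X>" "factor_by R M (S i) B X"
      have "below (S ` Field r) B = S i" using i bel by blast
      moreover have "i \<in> Field r" using i(1) by (auto simp: underS_def Field_def)
      ultimately show ?thesis using X by auto
    qed (use bel in auto)
  qed (use sub zero top in auto)
qed

text \<open>The chain is the range of the given family; zero, limit and successor indices yield the
  three alternatives of \<open>filt_chain_range\<close>.\<close>

lemma Filt_imp_filt_chain:
  fixes M :: "('a, 'b) module"
  assumes X: "semibrick R \<X>" and M: "M \<in> Filt R \<X>"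
  obtains C where "left_module R M" "filt_chain R \<X> M C"
proof -
  obtain r S where lm: "left_module R M" and F: "filtration_by R \<X> M (r :: 'b set rel) S"
    using M by (auto simp: Filt_def)
  interpret M: left_module R M by fact
  have wo: "Well_order r" and sub: "\<And>i. i \<in> Field r \<Longrightarrow> submodule (S i) R M"
    and mono: "\<And>i j. (i, j) \<in> r \<Longrightarrow> S i \<subseteq> S j"
    and zeroS: "\<And>i. wo_zero r i \<Longrightarrow> S i = {\<zero>\<^bsub>M\<^esub>}"
    and limS: "\<And>j. wo_limit r j \<Longrightarrow> S j = (\<Union>i\<in>underS r j. S i)"
    and top: "\<exists>\<mu>\<in>Field r. (\<forall>i\<in>Field r. (i, \<mu>) \<in> r) \<and> S \<mu> = carrier M"
    and sucS: "\<And>i j. wo_succ r i j \<Longrightarrow>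
      \<exists>A\<in>\<X>. lmod_isomorphic R (lmod_quot (M\<lparr>carrier := S j\<rparr>) (S i)) A"
    using F unfolding filtration_by_def filtration_def by blast+
  interpret r: wo_rel r by (simp add: wo wo_rel.intro)
  have "filt_chain R \<X> M (S ` Field r)"
  proof (rule filt_chain_range[OF wo sub mono])
    have "Field r \<noteq> {}" using top by blast
    then obtain i where i: "i \<in> Field r" "\<forall>j\<in>Field r. (i, j) \<in> r"
      using Linear_order_Well_order_iff[of r] wo r.LIN by blast
    have "wo_zero r i"
      using i r.ANTISYM by (auto simp: wo_zero_def underS_def Field_def dest: antisymD)
    then show "{\<zero>\<^bsub>M\<^esub>} \<in> S ` Field r" using zeroS i(1) by (metis imageI)
    show "carrier M \<in> S ` Field r" using top by (metis imageI)
  next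
    fix j assume j: "j \<in> Field r"
    consider "wo_zero r j" | i where "wo_succ r i j" | "wo_limit r j"
      using j by (auto simp: wo_limit_def)
    then show "S j = {\<zero>\<^bsub>M\<^esub>} \<or> S j = (\<Union>i\<in>underS r j. S i) \<or>
      (\<exists>i\<in>underS r j. (\<forall>k\<in>underS r j. S k \<subseteq> S i) \<and>
        (S j = S i \<or> (\<exists>X\<in>\<X>. factor_by R M (S i) (S j) X)))"
    proof cases
      case 2
      have i: "i \<in> Field r" and u: "underS r j = under r i" using 2 by (auto simp: wo_succ_def)
      have iu: "i \<in> underS r j" using i r.REFL unfolding u by (auto simp: under_def refl_on_def)
      have ij: "S i \<subseteq> S j" using iu mono by (auto simp: underS_def)
      obtain A where A: "A \<in> \<X>" "lmod_isomorphic R (lmod_quot (M\<lparr>carrier := S j\<rparr>) (S i)) A"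
        using sucS[OF 2] by blast
      have "left_module R A" using semibrickD(1)[OF X A(1)] .
      then have "factor_by R M (S i) (S j) A"
        using M.isomorphic_quot_iff_factor_by[OF sub[OF i] sub[OF j] ij] A(2) by blast
      moreover have "\<forall>k\<in>underS r j. S k \<subseteq> S i" unfolding u using mono by (auto simp: under_def)
      ultimately show ?thesis using iu A(1) by blast
    qed (use zeroS limS in auto)
  qed
  then show thesis using that lm by blast
qed

text \<open>The chain indexes itself, with \<open>id\<close> as the family, so the ordinal lives on
  sets of elements of \<open>M\<close>, as \<open>Filt\<close> demands.\<close>

lemma filt_chain_imp_Filt:
  fixes M :: "('a, 'b) module"
  assumes X: "semibrick R \<X>" and M: "left_module R M" and C: "filt_chain R \<X> M C"
  shows "M \<in> Filt R \<X>"
proof -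
  interpret M: left_module R M by fact
  note D = filt_chainD[OF C]
  let ?r = "incl_on C"
  have z: "{\<zero>\<^bsub>M\<^esub>} \<subseteq> B" if "B \<in> C" for B using submoduleD(2)[OF D(1)[OF that]] by simp
  have zero: "wo_zero ?r B \<longleftrightarrow> B = {\<zero>\<^bsub>M\<^esub>}" if "B \<in> C" for B
  proof
    assume "wo_zero ?r B"
    then have "\<not> {\<zero>\<^bsub>M\<^esub>} \<subset> B" using that D(3) by (auto simp: wo_zero_def incl_on_simps)
    then show "B = {\<zero>\<^bsub>M\<^esub>}" using z[OF that] by blast
  next
    assume "B = {\<zero>\<^bsub>M\<^esub>}"
    then show "wo_zero ?r B" using that z by (auto simp: wo_zero_def incl_on_simps)
  qed
  have "filtration R M ?r id"
    unfolding filtration_def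
  proof (intro conjI ballI allI impI)
    show "Well_order ?r" using D(2) by (rule Well_order_incl_on)
    show "submodule (id A) R M" if "A \<in> Field ?r" for A using that D(1) by (simp add: incl_on_simps)
    show "id A \<subseteq> id B" if "(A, B) \<in> ?r" for A B using that by (simp add: incl_on_def)
    show "id A = {\<zero>\<^bsub>M\<^esub>}" if "wo_zero ?r A" for A
      using that zero[of A] by (simp add: wo_zero_def incl_on_simps)
    show "id B = (\<Union>A\<in>underS ?r B. id A)" if B: "wo_limit ?r B" for B
    proof -
      have BC: "B \<in> C" using B by (simp add: wo_limit_def incl_on_simps)
      \<comment> \<open>Otherwise \<open>below C B\<close> would be an immediate predecessor of
        \<open>B\<close>, which a limit does not have.\<close>
      have "below C B = B"
      proof (rule ccontr)
        assume ne: "below C B \<noteq> B"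
        have "B \<noteq> {\<zero>\<^bsub>M\<^esub>}" using B BC zero by (simp add: wo_limit_def)
        then have b: "below C B \<in> C" using D(5)[OF BC] ne by blast
        have "{A \<in> C. A \<subset> B} = {A \<in> C. A \<subseteq> below C B}"
          using ne below_subset[of C B] by (auto simp: below_def)
        then have "wo_succ ?r (below C B) B" using b BC by (simp add: wo_succ_def incl_on_simps)
        then show False using B by (auto simp: wo_limit_def)
      qed
      then show ?thesis using BC by (simp add: incl_on_simps below_def)
    qed
    have "\<forall>A\<in>C. (A, carrier M) \<in> ?r" using D(4) submoduleD(1)[OF D(1)] by (auto simp: incl_on_def)
    then show "\<exists>\<mu>\<in>Field ?r. (\<forall>i\<in>Field ?r. (i, \<mu>) \<in> ?r) \<and> id \<mu> = carrier M"
      using D(4) by (auto simp: incl_on_simps)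
  qed
  moreover have "\<exists>X\<in>\<X>. lmod_isomorphic R (lmod_quot (M\<lparr>carrier := id B\<rparr>) (id A)) X"
    if AB: "wo_succ ?r A B" for A B
  proof -
    have A: "A \<in> C" and B: "B \<in> C"
      using AB by (auto simp: wo_succ_def incl_on_simps(1))
    have u: "{E \<in> C. E \<subset> B} = {E \<in> C. E \<subseteq> A}"
      using AB A B by (simp add: wo_succ_def incl_on_simps)
    have sub: "A \<subset> B" using u A by blast
    have bel: "below C B = A" unfolding below_def u using A by blast
    have "B \<noteq> {\<zero>\<^bsub>M\<^esub>}" using sub z[OF A] by blast
    then obtain X where X': "X \<in> \<X>" "factor_by R M A B X"
      using D(5)[OF B] bel sub by auto
    have "lmod_isomorphic R (lmod_quot (M\<lparr>carrier := B\<rparr>) A) X"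
      using M.isomorphic_quot_iff_factor_by[OF D(1)[OF A] D(1)[OF B]
          psubset_imp_subset[OF sub] semibrickD(1)[OF X X'(1)]] X'(2) by simp
    then show ?thesis using X'(1) by (intro bexI[of _ X]) simp_all
  qed
  ultimately have "filtration_by R \<X> M ?r id" by (simp add: filtration_by_def)
  then show ?thesis using M by (auto simp: Filt_def)
qed

subsection \<open>Submodules compatible with a chain\<close>

context left_module
begin

lemma eq_minus_if_add_eq:
  assumes "a \<in> carrier M" "b \<in> carrier M" "x = a \<oplus>\<^bsub>M\<^esub> b"
  shows "b = x \<ominus>\<^bsub>M\<^esub> a" "a = x \<ominus>\<^bsub>M\<^esub> b"
proof -
  show "a = x \<ominus>\<^bsub>M\<^esub> b" using assms by (simp add: a_minus_def M.a_assoc M.r_neg)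
  have "x = b \<oplus>\<^bsub>M\<^esub> a" using assms by (simp add: M.a_comm)
  then show "b = x \<ominus>\<^bsub>M\<^esub> a" using assms(1,2) by (simp add: a_minus_def M.a_assoc M.r_neg)
qed

lemma minus_add_distrib:
  "a \<in> carrier M \<Longrightarrow> b \<in> carrier M \<Longrightarrow> c \<in> carrier M \<Longrightarrow> d \<in> carrier M \<Longrightarrow>
   (a \<oplus>\<^bsub>M\<^esub> b) \<ominus>\<^bsub>M\<^esub> (c \<oplus>\<^bsub>M\<^esub> d) = (a \<ominus>\<^bsub>M\<^esub> c) \<oplus>\<^bsub>M\<^esub> (b \<ominus>\<^bsub>M\<^esub> d)"
  by (simp add: a_minus_def M.minus_add M.a_ac)

lemma add_add_distrib:
  "a \<in> carrier M \<Longrightarrow> b \<in> carrier M \<Longrightarrow> c \<in> carrier M \<Longrightarrow> d \<in> carrier M \<Longrightarrow>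
   (a \<oplus>\<^bsub>M\<^esub> b) \<oplus>\<^bsub>M\<^esub> (c \<oplus>\<^bsub>M\<^esub> d) = (a \<oplus>\<^bsub>M\<^esub> c) \<oplus>\<^bsub>M\<^esub> (b \<oplus>\<^bsub>M\<^esub> d)"
  by (simp add: M.a_ac)

lemma subset_set_add:
  assumes "submodule A R M" "submodule B R M"
  shows "A \<subseteq> A <+>\<^bsub>M\<^esub> B" "B \<subseteq> A <+>\<^bsub>M\<^esub> B"
proof -
  note A = submoduleD[OF assms(1)] and B = submoduleD[OF assms(2)]
  show "A \<subseteq> A <+>\<^bsub>M\<^esub> B"
  proof
    fix x assume "x \<in> A"
    then show "x \<in> A <+>\<^bsub>M\<^esub> B" using set_addI[OF _ B(2), of x A M] A(1) by auto
  qed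
  show "B \<subseteq> A <+>\<^bsub>M\<^esub> B"
  proof
    fix x assume "x \<in> B"
    then show "x \<in> A <+>\<^bsub>M\<^esub> B" using set_addI[OF A(2), of x B M] B(1) by auto
  qed
qed

lemma submodule_vimage:
  assumes N: "left_module R N" and h: "h \<in> lmod_hom R M N" and H: "submodule H R N"
  shows "submodule {x \<in> carrier M. h x \<in> H} R M"
proof -
  interpret N: left_module R N by fact
  show ?thesis
    using lmod_homD[OF N h] submoduleD[OF H] by (intro submoduleI) auto
qed

lemma submodule_image:
  assumes N: "left_module R N" and h: "h \<in> lmod_hom R M N" and P: "submodule P R M"
  shows "submodule (h ` P) R N"
proof -
  interpret N: left_module R N by fact
  note h' = lmod_homD[OF N h] and P' = submoduleD[OF P]
  have c: "\<And>x. x \<in> P \<Longrightarrow> x \<in> carrier M" using P'(1) by blast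
  show ?thesis
  proof (rule N.submoduleI)
    show "h ` P \<subseteq> carrier N" using h'(1) c by blast
    show "\<zero>\<^bsub>N\<^esub> \<in> h ` P" using h'(4) P'(2) by (metis imageI)
  next
    fix x y assume "x \<in> h ` P" "y \<in> h ` P"
    then obtain u v where "u \<in> P" "v \<in> P" "x = h u" "y = h v" by blast
    then show "x \<oplus>\<^bsub>N\<^esub> y \<in> h ` P" using h'(2) c P'(3) by (metis imageI)
  next
    fix a x assume "a \<in> carrier R" "x \<in> h ` P"
    then obtain u where "a \<in> carrier R" "u \<in> P" "x = h u" by blast
    then show "a \<odot>\<^bsub>N\<^esub> x \<in> h ` P" using h'(3) c P'(6) by (metis imageI)
  qed
qed

end

lemma set_add_mono: "A \<subseteq> A' \<Longrightarrow> B \<subseteq> B' \<Longrightarrow> A <+>\<^bsub>M\<^esub> B \<subseteq> A' <+>\<^bsub>M\<^esub> B'"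
  by (auto simp: set_add_def')

lemma set_add_least:
  assumes "submodule H R M" "A \<subseteq> H" "B \<subseteq> H"
  shows "A <+>\<^bsub>M\<^esub> B \<subseteq> H"
  using assms submoduleD(3)[OF assms(1)] by (auto elim!: set_addE)

text \<open>At a successor, by the modular law, the image of \<open>B \<inter> K\<close> in
  \<open>B / below C B\<close> is everything or zero. For submodules \<open>K\<close>, limit members
  satisfy the first alternative; the zero member of a filtration chain satisfies the second, its
  \<open>below\<close> being empty.\<close>

definition chain_compatible :: "('a, 'b) module \<Rightarrow> 'b set set \<Rightarrow> 'b set \<Rightarrow> bool" where
  "chain_compatible M C K \<longleftrightarrow>
    (\<forall>B\<in>C. B \<subseteq> below C B <+>\<^bsub>M\<^esub> K \<or> B \<inter> (below C B <+>\<^bsub>M\<^esub> K) \<subseteq> below C B)"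

text \<open>By the second isomorphism theorem \<open>(B \<inter> K) / (U \<inter> K)\<close> embeds
  into \<open>B / U\<close>, where \<open>U\<close> is \<open>below C B\<close>, and compatibility
  leaves only the zero and the full image. Intersecting may identify members of the chain, which
  \<open>filt_chain_range\<close> tolerates.\<close>

lemma filt_chain_restrict:
  assumes M: "left_module R M" and C: "filt_chain R \<X> M C" and X: "\<forall>X\<in>\<X>. left_module R X"
    and K: "submodule K R M" and cc: "chain_compatible M C K"
  shows "filt_chain R \<X> (M\<lparr>carrier := K\<rparr>) ((\<lambda>A. A \<inter> K) ` C)"
proof -
  interpret M: left_module R M by fact
  note D = filt_chainD[OF C] and K' = submoduleD[OF K]
  have "filt_chain R \<X> (M\<lparr>carrier := K\<rparr>) ((\<lambda>A. A \<inter> K) ` Field (incl_on C))"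
  proof (rule filt_chain_range)
    show "Well_order (incl_on C)" using D(2) by (rule Well_order_incl_on)
    show "submodule (A \<inter> K) R (M\<lparr>carrier := K\<rparr>)" if "A \<in> Field (incl_on C)" for A
      using that M.submodule_restrict[OF K M.submodule_Int[OF D(1) K]] by (simp add: incl_on_simps)
    show "A \<inter> K \<subseteq> B \<inter> K" if "(A, B) \<in> incl_on C" for A B
      using that by (auto simp: incl_on_def)
    show "{\<zero>\<^bsub>M\<lparr>carrier := K\<rparr>\<^esub>} \<in> (\<lambda>A. A \<inter> K) ` Field (incl_on C)"
      using D(3) K'(2) unfolding incl_on_simps by (intro image_eqI[of _ _ "{\<zero>\<^bsub>M\<^esub>}"]) auto
    show "carrier (M\<lparr>carrier := K\<rparr>) \<in> (\<lambda>A. A \<inter> K) ` Field (incl_on C)"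
      using D(4) K'(1) unfolding incl_on_simps by (intro image_eqI[of _ _ "carrier M"]) auto
  next
    fix B assume "B \<in> Field (incl_on C)"
    then have B: "B \<in> C" by (simp add: incl_on_simps)
    let ?U = "below C B"
    note B' = submoduleD[OF D(1)[OF B]]
    consider "B = {\<zero>\<^bsub>M\<^esub>}" | "?U = B" | X where "?U \<noteq> B" "?U \<in> C" "X \<in> \<X>" "factor_by R M ?U B X"
      using D(5)[OF B] by blast
    then show "B \<inter> K = {\<zero>\<^bsub>M\<lparr>carrier := K\<rparr>\<^esub>} \<or> B \<inter> K = (\<Union>A\<in>underS (incl_on C) B. A \<inter> K) \<or>
      (\<exists>A\<in>underS (incl_on C) B. (\<forall>E\<in>underS (incl_on C) B. E \<inter> K \<subseteq> A \<inter> K) \<and>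
        (B \<inter> K = A \<inter> K \<or> (\<exists>X\<in>\<X>. factor_by R (M\<lparr>carrier := K\<rparr>) (A \<inter> K) (B \<inter> K) X)))"
    proof cases
      case 1
      then show ?thesis using K'(2) by auto
    next
      case 2
      then have "B = \<Union>{A \<in> C. A \<subset> B}" by (simp add: below_def)
      then have "B \<inter> K = (\<Union>A\<in>{A \<in> C. A \<subset> B}. A \<inter> K)" by blast
      then show ?thesis unfolding incl_on_simps(3)[OF B] by blast
    next
      case 3
      have U: "?U \<in> {A \<in> C. A \<subset> B}" using 3(1,2) below_subset[of C B] by blast
      have max: "\<forall>E\<in>{A \<in> C. A \<subset> B}. E \<inter> K \<subseteq> ?U \<inter> K" by (auto simp: below_def)
      note U' = submoduleD[OF D(1)[OF 3(2)]]
      interpret X: left_module R X using X 3(3) by blast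
      have "B \<inter> K = ?U \<inter> K \<or> (\<exists>X\<in>\<X>. factor_by R (M\<lparr>carrier := K\<rparr>) (?U \<inter> K) (B \<inter> K) X)"
      proof (cases "B \<subseteq> ?U <+>\<^bsub>M\<^esub> K")
        case False
        then have "B \<inter> (?U <+>\<^bsub>M\<^esub> K) \<subseteq> ?U" using cc B by (auto simp: chain_compatible_def)
        then have "B \<inter> K \<subseteq> ?U" using M.subset_set_add(2)[OF D(1)[OF 3(2)] K] by blast
        then show ?thesis using U by blast
      next
        case True
        obtain p where p: "p \<in> lmod_hom R (M\<lparr>carrier := B\<rparr>) X" and onto: "p ` B = carrier X"
          and ker: "\<And>x. x \<in> B \<Longrightarrow> p x = \<zero>\<^bsub>X\<^esub> \<longleftrightarrow> x \<in> ?U"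
          using 3(4) by (auto simp: factor_by_def)
        note p' = M.lmod_hom_restrictD[OF D(1)[OF B] X.left_module_axioms p]
        have "p \<in> lmod_hom R (M\<lparr>carrier := B \<inter> K\<rparr>) X" using p by (auto simp: lmod_hom_def)
        \<comment> \<open>Write an element of \<open>B\<close> as \<open>u\<close> plus
          \<open>k\<close> with \<open>u\<close> in \<open>?U\<close> and \<open>k\<close> in
          \<open>K\<close>. Then \<open>k\<close> also lies in \<open>B\<close> and has the same
          image, since \<open>p\<close> kills \<open>u\<close>.\<close>
        moreover have "p ` (B \<inter> K) = carrier X"
        proof
          show "p ` (B \<inter> K) \<subseteq> carrier X" using onto by blast
          show "carrier X \<subseteq> p ` (B \<inter> K)"
          proof
            fix v assume "v \<in> carrier X"
            then obtain b where b: "b \<in> B" "v = p b" using onto by blast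
            obtain u k where uk: "u \<in> ?U" "k \<in> K" "b = u \<oplus>\<^bsub>M\<^esub> k"
              using True b(1) by (blast elim: set_addE)
            have uB: "u \<in> B" using uk(1) U by blast
            have "k = b \<ominus>\<^bsub>M\<^esub> u"
              using M.eq_minus_if_add_eq(1)[of u k b] uk U'(1) K'(1) by blast
            then have "k \<in> B" "p k = p b \<ominus>\<^bsub>X\<^esub> p u" using B'(5) b uB p'(5) by auto
            moreover have "p u = \<zero>\<^bsub>X\<^esub>" using ker uB uk by blast
            ultimately have "p k = v" using b p'(1) by (simp add: a_minus_def)
            then show "v \<in> p ` (B \<inter> K)" using \<open>k \<in> B\<close> uk(2) by blast
          qed
        qed
        ultimately have "factor_by R (M\<lparr>carrier := K\<rparr>) (?U \<inter> K) (B \<inter> K) X"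
          using ker unfolding factor_by_def by (intro bexI[of _ p]) auto
        then show ?thesis using 3(3) by blast
      qed
      then show ?thesis using U max unfolding incl_on_simps(3)[OF B] by blast
    qed
  qed
  then show ?thesis by (simp add: incl_on_simps)
qed

text \<open>Each element of \<open>T\<close> needs only one member strictly below the limit
  \<open>B\<close>, and the largest of finitely many members of a chain serves for all. That
  \<open>B\<close> is nonzero provides a member for the empty set.\<close>

lemma finite_set_in_below:
  assumes C: "filt_chain R \<X> N C" and B: "B \<in> C" "below C B = B" "B \<noteq> {\<zero>\<^bsub>N\<^esub>}"
    and T: "finite T" "T \<subseteq> B <+>\<^bsub>N\<^esub> K"
  shows "\<exists>A\<in>C. A \<subset> B \<and> T \<subseteq> A <+>\<^bsub>N\<^esub> K"
  using T
proof (induction T rule: finite_induct)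
  case empty
  note D = filt_chainD[OF C]
  have "{\<zero>\<^bsub>N\<^esub>} \<subset> B" using B(3) submoduleD(2)[OF D(1)[OF B(1)]] by blast
  then show ?case using D(3) by blast
next
  case (insert t T)
  note D = filt_chainD[OF C]
  obtain A where A: "A \<in> C" "A \<subset> B" "T \<subseteq> A <+>\<^bsub>N\<^esub> K" using insert by blast
  have "t \<in> B <+>\<^bsub>N\<^esub> K" using insert.prems by blast
  then obtain b k where bk: "b \<in> B" "k \<in> K" "t = b \<oplus>\<^bsub>N\<^esub> k" by (rule set_addE)
  then have "b \<in> below C B" using B(2) by simp
  then obtain A' where A': "A' \<in> C" "A' \<subset> B" "b \<in> A'" by (auto simp: below_def)
  have t: "t \<in> A' <+>\<^bsub>N\<^esub> K" using A'(3) bk set_addI by metis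
  show ?case
  proof (cases "A \<subseteq> A'")
    case True
    then have "T \<subseteq> A' <+>\<^bsub>N\<^esub> K" using A(3) set_add_mono[OF True subset_refl] by blast
    then show ?thesis using A' t by blast
  next
    case False
    then have "A' \<subseteq> A" using D(6) A A' by blast
    then have "t \<in> A <+>\<^bsub>N\<^esub> K" using t set_add_mono[of A' A K K N] by blast
    then show ?thesis using A by blast
  qed
qed

text \<open>Take the least \<open>B\<close> in the chain of \<open>N\<close> with \<open>h ` Q \<subseteq> B + h ` P\<close>. Finite generation excludes limits,
  and the map induced by \<open>h\<close> from \<open>Q / P\<close> to the factor at \<open>B\<close> is a nonzero map of the semibrick,
  hence an isomorphism.\<close>

lemma chain_compatible_step:
  assumes X: "semibrick R \<X>" and M: "left_module R M" and N: "left_module R N"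
    and h: "h \<in> lmod_hom R M N" and C: "filt_chain R \<X> N C"
    and P: "submodule P R M" and Q: "submodule Q R M" and PQ: "P \<subseteq> Q"
    and X1: "X1 \<in> \<X>" and fac: "factor_by R M P Q X1"
    and cc: "chain_compatible N C (h ` P)"
  shows "chain_compatible N C (h ` Q) \<and> (h ` Q \<subseteq> h ` P \<or> (\<forall>x\<in>Q. h x \<in> h ` P \<longrightarrow> x \<in> P))"
proof (cases "h ` Q \<subseteq> h ` P")
  case True
  then have "h ` Q = h ` P" using PQ by blast
  then show ?thesis using cc by simp
next
  case nsub: False
  interpret M: left_module R M by fact
  interpret N: left_module R N by fact
  note D = filt_chainD[OF C] and h' = M.lmod_homD[OF N h]
  define K where "K = h ` P"
  have K: "submodule K R N" unfolding K_def using N h P by (rule M.submodule_image)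
  have K': "submodule (h ` Q) R N" using N h Q by (rule M.submodule_image)
  have KK': "K \<subseteq> h ` Q" using PQ by (auto simp: K_def)
  have Qc: "\<And>x. x \<in> Q \<Longrightarrow> x \<in> carrier M" using submoduleD(1)[OF Q] by blast
  have Kc: "\<And>x. x \<in> K \<Longrightarrow> x \<in> carrier N" using submoduleD(1)[OF K] by blast
  let ?D = "{B \<in> C. h ` Q \<subseteq> B <+>\<^bsub>N\<^esub> K}"
  have "h ` Q \<subseteq> carrier N <+>\<^bsub>N\<^esub> K"
    using N.subset_set_add(1)[OF N.submodule_carrier K] submoduleD(1)[OF K'] by blast
  then have "carrier N \<in> ?D" using D(4) by blast
  then have "\<exists>B\<in>?D. \<forall>B'\<in>?D. B \<subseteq> B'" by (intro D(2)) auto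
  then obtain B where B1: "B \<in> ?D" and B2: "\<forall>B'\<in>?D. B \<subseteq> B'" by blast
  have B: "B \<in> C" "h ` Q \<subseteq> B <+>\<^bsub>N\<^esub> K" using B1 by auto
  have least: "B \<subseteq> B'" if "B' \<in> C" "h ` Q \<subseteq> B' <+>\<^bsub>N\<^esub> K" for B' using B2 that by blast
  note Bs = D(1)[OF B(1)]
  have Bc: "\<And>x. x \<in> B \<Longrightarrow> x \<in> carrier N" using submoduleD(1)[OF Bs] by blast
  have B0: "B \<noteq> {\<zero>\<^bsub>N\<^esub>}"
  proof
    assume "B = {\<zero>\<^bsub>N\<^esub>}"
    then have "h ` Q \<subseteq> K"
      using B(2) set_add_least[OF K, of "{\<zero>\<^bsub>N\<^esub>}" K] submoduleD(2)[OF K] by blast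
    then show False using nsub by (simp add: K_def)
  qed
  define U where "U = below C B"
  have UB: "U \<subseteq> B" unfolding U_def by (rule below_subset)
  have "U \<noteq> B"
  proof
    assume lim: "U = B"
    obtain T where T: "finite T" "T \<subseteq> Q"
      "\<And>H. submodule H R M \<Longrightarrow> P \<subseteq> H \<Longrightarrow> H \<subseteq> Q \<Longrightarrow> T \<subseteq> H \<Longrightarrow> Q \<subseteq> H"
      by (rule factor_by_generators[OF M P Q semibrickD(2)[OF X X1] fac], rule that) simp_all
    obtain A where A: "A \<in> C" "A \<subset> B" "h ` T \<subseteq> A <+>\<^bsub>N\<^esub> K"
      using finite_set_in_below[OF C B(1) lim[unfolded U_def] B0, of "h ` T" K] T(1,2) B(2) by blast
    note AK = N.submodule_set_add[OF D(1)[OF A(1)] K]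
    \<comment> \<open>The part of \<open>Q\<close> that \<open>h\<close> sends into
      \<open>A + K\<close>. It contains \<open>P\<close> and the generators \<open>T\<close>, hence
      all of \<open>Q\<close>, against the minimality of \<open>B\<close>.\<close>
    let ?H = "Q \<inter> {x \<in> carrier M. h x \<in> A <+>\<^bsub>N\<^esub> K}"
    have "Q \<subseteq> ?H"
    proof (rule T(3))
      show "submodule ?H R M" by (rule M.submodule_Int[OF Q M.submodule_vimage[OF N h AK]])
      show "P \<subseteq> ?H"
        using PQ Qc N.subset_set_add(2)[OF D(1)[OF A(1)] K] by (auto simp: K_def)
      show "T \<subseteq> ?H" using T(2) A(3) Qc by auto
    qed auto
    then have "h ` Q \<subseteq> A <+>\<^bsub>N\<^esub> K" by auto
    then show False using least[OF A(1)] A(2) by blast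
  qed
  then obtain Y where UC: "U \<in> C" and Y: "Y \<in> \<X>" and facY: "factor_by R N U B Y"
    using D(5)[OF B(1)] B0 unfolding U_def by blast
  note Us = D(1)[OF UC]
  note UK = N.submodule_set_add[OF Us K]
  have nUK: "\<not> h ` Q \<subseteq> U <+>\<^bsub>N\<^esub> K" using least[OF UC] UB \<open>U \<noteq> B\<close> by blast
  have "\<not> B \<subseteq> U <+>\<^bsub>N\<^esub> K"
  proof
    assume "B \<subseteq> U <+>\<^bsub>N\<^esub> K"
    then have "B <+>\<^bsub>N\<^esub> K \<subseteq> U <+>\<^bsub>N\<^esub> K"
      using set_add_least[OF UK] N.subset_set_add(2)[OF Us K] by blast
    then show False using nUK B(2) by blast
  qed
  \<comment> \<open>So passing modulo \<open>K\<close> does not change the factor at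
    \<open>B\<close>, and the brick \<open>Y\<close> can serve as target of the induced map.\<close>
  then have BU: "B \<inter> (U <+>\<^bsub>N\<^esub> K) \<subseteq> U"
    using cc B(1) unfolding chain_compatible_def K_def U_def by blast
  interpret X1: left_module R X1 using semibrickD(1)[OF X X1] .
  interpret Y: left_module R Y using semibrickD(1)[OF X Y] .
  obtain p where p: "p \<in> lmod_hom R (M\<lparr>carrier := Q\<rparr>) X1" and p_onto: "p ` Q = carrier X1"
    and p_ker: "\<And>x. x \<in> Q \<Longrightarrow> p x = \<zero>\<^bsub>X1\<^esub> \<longleftrightarrow> x \<in> P"
    using fac by (auto simp: factor_by_def)
  obtain q where q: "q \<in> lmod_hom R (N\<lparr>carrier := B\<rparr>) Y" and q_onto: "q ` B = carrier Y"
    and q_ker: "\<And>x. x \<in> B \<Longrightarrow> q x = \<zero>\<^bsub>Y\<^esub> \<longleftrightarrow> x \<in> U"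
    using facY by (auto simp: factor_by_def)
  note p' = M.lmod_hom_restrictD[OF Q X1.left_module_axioms p]
  note q' = N.lmod_hom_restrictD[OF Bs Y.left_module_axioms q]
  \<comment> \<open>\<open>b\<close> is a component of \<open>h x\<close> in \<open>B\<close> modulo
    \<open>K\<close>. It is unique up to \<open>B \<inter> K\<close>, which lies in \<open>U\<close>
    by \<open>BU\<close>, so \<open>q b\<close> depends on \<open>x\<close> alone. Working with this
    relation avoids forming quotients by \<open>U + K\<close>.\<close>
  define rel where "rel x b \<longleftrightarrow> x \<in> Q \<and> b \<in> B \<and> (\<exists>k\<in>K. h x = b \<oplus>\<^bsub>N\<^esub> k)" for x b
  have relD: "x \<in> Q" "b \<in> B" if "rel x b" for x b using that by (auto simp: rel_def)
  have rel_ex: "\<exists>b. rel x b" if "x \<in> Q" for x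
  proof -
    have "h x \<in> B <+>\<^bsub>N\<^esub> K" using that B(2) by blast
    then show ?thesis using that by (auto simp: rel_def elim!: set_addE)
  qed
  have rel_add: "rel (x \<oplus>\<^bsub>M\<^esub> y) (b \<oplus>\<^bsub>N\<^esub> c)" if xy: "rel x b" "rel y c" for x y b c
  proof -
    obtain k l where kl: "k \<in> K" "l \<in> K" "h x = b \<oplus>\<^bsub>N\<^esub> k" "h y = c \<oplus>\<^bsub>N\<^esub> l"
      using xy by (auto simp: rel_def)
    have "h (x \<oplus>\<^bsub>M\<^esub> y) = (b \<oplus>\<^bsub>N\<^esub> c) \<oplus>\<^bsub>N\<^esub> (k \<oplus>\<^bsub>N\<^esub> l)"
      using h'(2) relD[OF xy(1)] relD[OF xy(2)] kl Qc Bc Kc N.add_add_distrib by simp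
    then show ?thesis
      using relD[OF xy(1)] relD[OF xy(2)] submoduleD(3)[OF Q] submoduleD(3)[OF Bs]
        submoduleD(3)[OF K kl(1,2)] unfolding rel_def by blast
  qed
  have rel_minus: "rel (x \<ominus>\<^bsub>M\<^esub> y) (b \<ominus>\<^bsub>N\<^esub> c)" if xy: "rel x b" "rel y c" for x y b c
  proof -
    obtain k l where kl: "k \<in> K" "l \<in> K" "h x = b \<oplus>\<^bsub>N\<^esub> k" "h y = c \<oplus>\<^bsub>N\<^esub> l"
      using xy by (auto simp: rel_def)
    have "h (x \<ominus>\<^bsub>M\<^esub> y) = (b \<ominus>\<^bsub>N\<^esub> c) \<oplus>\<^bsub>N\<^esub> (k \<ominus>\<^bsub>N\<^esub> l)"
      using h'(5) relD[OF xy(1)] relD[OF xy(2)] kl Qc Bc Kc N.minus_add_distrib by simp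
    then show ?thesis
      using relD[OF xy(1)] relD[OF xy(2)] submoduleD(5)[OF Q] submoduleD(5)[OF Bs]
        submoduleD(5)[OF K kl(1,2)] unfolding rel_def by blast
  qed
  have rel_smult: "rel (a \<odot>\<^bsub>M\<^esub> x) (a \<odot>\<^bsub>N\<^esub> b)" if a: "a \<in> carrier R" and xb: "rel x b" for a x b
  proof -
    obtain k where k: "k \<in> K" "h x = b \<oplus>\<^bsub>N\<^esub> k" using xb by (auto simp: rel_def)
    have "h (a \<odot>\<^bsub>M\<^esub> x) = a \<odot>\<^bsub>N\<^esub> b \<oplus>\<^bsub>N\<^esub> a \<odot>\<^bsub>N\<^esub> k"
      using h'(3) relD[OF xb] k a Qc Bc Kc N.smult_r_distr by simp
    then show ?thesis
      using relD[OF xb] submoduleD(6)[OF Q a] submoduleD(6)[OF Bs a] submoduleD(6)[OF K a k(1)]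
      unfolding rel_def by blast
  qed
  have rel_zero: "q b = \<zero>\<^bsub>Y\<^esub>" if xb: "rel x b" and x: "p x = \<zero>\<^bsub>X1\<^esub>" for x b
  proof -
    obtain k where k: "k \<in> K" "h x = b \<oplus>\<^bsub>N\<^esub> k" using xb by (auto simp: rel_def)
    have "h x \<in> K" using p_ker x relD(1)[OF xb] unfolding K_def by blast
    moreover have "b = h x \<ominus>\<^bsub>N\<^esub> k"
      using N.eq_minus_if_add_eq(2)[OF _ _ k(2)] Bc Kc relD(2)[OF xb] k(1) by blast
    ultimately have "b \<in> K" using submoduleD(5)[OF K] k(1) by simp
    then have "b \<in> U" using BU relD(2)[OF xb] N.subset_set_add(2)[OF Us K] by blast
    then show ?thesis using q_ker relD(2)[OF xb] by blast
  qed
  \<comment> \<open>The induced map from \<open>X1\<close> to \<open>Y\<close>: lift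
    \<open>v\<close> along \<open>p\<close>, apply \<open>h\<close>, take the component in
    \<open>B\<close> and project by \<open>q\<close>. \<open>rel_zero\<close> makes it independent
    of the choices.\<close>
  define g where "g v = (SOME w. \<exists>x b. rel x b \<and> p x = v \<and> w = q b)" for v
  have g: "g (p x) = q b" if xb: "rel x b" for x b
  proof -
    have "\<exists>x' b'. rel x' b' \<and> p x' = p x \<and> g (p x) = q b'"
      unfolding g_def by (rule someI[of _ "q b"]) (use xb in blast)
    then obtain x' b' where x': "rel x' b'" "p x' = p x" "g (p x) = q b'" by blast
    have "p (x \<ominus>\<^bsub>M\<^esub> x') = \<zero>\<^bsub>X1\<^esub>"
      using p'(5)[OF relD(1)[OF xb] relD(1)[OF x'(1)]] p'(1)[OF relD(1)[OF xb]] x'(2)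
        X1.a_minus_eq_zero_iff by simp
    then have "q (b \<ominus>\<^bsub>N\<^esub> b') = \<zero>\<^bsub>Y\<^esub>" using rel_zero[OF rel_minus[OF xb x'(1)]] by simp
    then have "q b = q b'"
      using q'(5)[OF relD(2)[OF xb] relD(2)[OF x'(1)]] q'(1) relD(2)[OF xb] relD(2)[OF x'(1)]
        Y.a_minus_eq_zero_iff by simp
    then show ?thesis using x'(3) by simp
  qed
  have lift: "\<exists>x b. rel x b \<and> v = p x" if "v \<in> carrier X1" for v
    using that p_onto rel_ex by (metis imageE)
  have ghom: "g \<in> lmod_hom R X1 Y"
    unfolding lmod_hom_def
  proof (intro CollectI conjI ballI funcsetI)
    fix v assume "v \<in> carrier X1"
    then obtain x b where x: "rel x b" "v = p x" using lift by blast
    then show "g v \<in> carrier Y" using g q'(1) relD(2) by simp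
    fix w assume "w \<in> carrier X1"
    then obtain y c where y: "rel y c" "w = p y" using lift by blast
    have "v \<oplus>\<^bsub>X1\<^esub> w = p (x \<oplus>\<^bsub>M\<^esub> y)" using x y p'(2) relD(1) by simp
    then show "g (v \<oplus>\<^bsub>X1\<^esub> w) = g v \<oplus>\<^bsub>Y\<^esub> g w"
      using g[OF rel_add[OF x(1) y(1)]] g[OF x(1)] g[OF y(1)] x y q'(2) relD(2) by simp
  next
    fix a v assume a: "a \<in> carrier R" and "v \<in> carrier X1"
    then obtain x b where x: "rel x b" "v = p x" using lift by blast
    have "a \<odot>\<^bsub>X1\<^esub> v = p (a \<odot>\<^bsub>M\<^esub> x)" using x p'(3)[OF a] relD(1) by simp
    then show "g (a \<odot>\<^bsub>X1\<^esub> v) = a \<odot>\<^bsub>Y\<^esub> g v"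
      using g[OF rel_smult[OF a x(1)]] g[OF x(1)] x q'(3)[OF a] relD(2) by simp
  qed
  \<comment> \<open>If \<open>g\<close> vanished, \<open>h\<close> would send \<open>Q\<close> into
    \<open>U + K\<close>, although \<open>B\<close> is minimal.\<close>
  have "\<not> (\<forall>v\<in>carrier X1. g v = \<zero>\<^bsub>Y\<^esub>)"
  proof
    assume g0: "\<forall>v\<in>carrier X1. g v = \<zero>\<^bsub>Y\<^esub>"
    have "h x \<in> U <+>\<^bsub>N\<^esub> K" if x: "x \<in> Q" for x
    proof -
      obtain b where b: "rel x b" using rel_ex[OF x] by blast
      have "q b = \<zero>\<^bsub>Y\<^esub>" using g[OF b] g0 p'(1)[OF x] by simp
      then have "b \<in> U" using q_ker relD(2)[OF b] by blast
      then show ?thesis using b set_addI unfolding rel_def by metis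
    qed
    then show False using nUK by blast
  qed
  then have gbij: "bij_betw g (carrier X1) (carrier Y)"
    using semibrick_hom_cases[OF X X1 Y ghom] by blast
  have g_zero: "g \<zero>\<^bsub>X1\<^esub> = \<zero>\<^bsub>Y\<^esub>"
    using X1.lmod_homD(4)[OF Y.left_module_axioms ghom] .
  \<comment> \<open>Injectivity of \<open>g\<close> gives more than injectivity modulo
    \<open>h P\<close>: even \<open>h x\<close> in \<open>U + K\<close> forces \<open>x\<close> into
    \<open>P\<close>. Members strictly below \<open>B\<close> need this stronger form.\<close>
  have inj: "x \<in> P" if x: "x \<in> Q" and hx: "h x \<in> U <+>\<^bsub>N\<^esub> K" for x
  proof -
    obtain u k where uk: "u \<in> U" "k \<in> K" "h x = u \<oplus>\<^bsub>N\<^esub> k" using hx by (rule set_addE)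
    have uB: "u \<in> B" using uk(1) UB by blast
    have "rel x u" using x uB uk by (auto simp: rel_def)
    then have "g (p x) = \<zero>\<^bsub>Y\<^esub>" using g q_ker[OF uB] uk(1) by simp
    then have "p x = \<zero>\<^bsub>X1\<^esub>"
      using g_zero gbij p'(1)[OF x] X1.M.zero_closed by (metis bij_betw_def inj_onD)
    then show ?thesis using p_ker[OF x] by simp
  qed
  have surj: "B \<subseteq> U <+>\<^bsub>N\<^esub> h ` Q"
  proof
    fix b assume b: "b \<in> B"
    then obtain v where v: "v \<in> carrier X1" "g v = q b"
      using gbij q'(1)[OF b] unfolding bij_betw_def by (metis imageE)
    then obtain x c where x: "rel x c" "v = p x" using lift by blast
    have c: "c \<in> B" using relD(2)[OF x(1)] .
    have "q c = q b" using g[OF x(1)] v(2) x(2) by simp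
    then have "q (b \<ominus>\<^bsub>N\<^esub> c) = \<zero>\<^bsub>Y\<^esub>"
      using q'(5)[OF b c] q'(1) b c Y.a_minus_eq_zero_iff by simp
    then have bc: "b \<ominus>\<^bsub>N\<^esub> c \<in> U" using q_ker submoduleD(5)[OF Bs b c] by blast
    obtain k where k: "k \<in> K" "h x = c \<oplus>\<^bsub>N\<^esub> k" using x(1) by (auto simp: rel_def)
    have "c = h x \<ominus>\<^bsub>N\<^esub> k" using N.eq_minus_if_add_eq(2)[OF _ _ k(2)] Bc[OF c] Kc[OF k(1)] by blast
    then have "c \<in> h ` Q" using submoduleD(5)[OF K'] k(1) KK' relD(1)[OF x(1)] by blast
    then have "(b \<ominus>\<^bsub>N\<^esub> c) \<oplus>\<^bsub>N\<^esub> c \<in> U <+>\<^bsub>N\<^esub> h ` Q" using bc by (intro set_addI)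
    then show "b \<in> U <+>\<^bsub>N\<^esub> h ` Q" using N.a_minus_add_cancel[OF Bc[OF b] Bc[OF c]] by simp
  qed
  have "E \<subseteq> below C E <+>\<^bsub>N\<^esub> h ` Q \<or> E \<inter> (below C E <+>\<^bsub>N\<^esub> h ` Q) \<subseteq> below C E" if E: "E \<in> C" for E
  proof (cases "E \<subseteq> below C E <+>\<^bsub>N\<^esub> K")
    case True
    then show ?thesis using set_add_mono[OF subset_refl KK', of N "below C E"] by blast
  next
    case False
    let ?V = "below C E"
    have EV: "E \<inter> (?V <+>\<^bsub>N\<^esub> K) \<subseteq> ?V"
      using False cc E unfolding chain_compatible_def K_def by blast
    have Ec: "\<And>x. x \<in> E \<Longrightarrow> x \<in> carrier N" using submoduleD(1)[OF D(1)[OF E]] by blast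
    consider "E = B" | "E \<subset> B" | "B \<subset> E" using D(6)[OF E B(1)] by blast
    then show ?thesis
    proof cases
      case 1
      then show ?thesis using surj by (simp add: U_def)
    next
      case 2
      then have EU: "E \<subseteq> U" using E by (auto simp: U_def below_def)
      have "x \<in> ?V" if x: "x \<in> E" and xV: "x \<in> ?V <+>\<^bsub>N\<^esub> h ` Q" for x
      proof -
        obtain v k where vk: "v \<in> ?V" "k \<in> h ` Q" "x = v \<oplus>\<^bsub>N\<^esub> k" using xV by (rule set_addE)
        obtain y where y: "y \<in> Q" "k = h y" using vk(2) by blast
        have vE: "v \<in> E" using vk(1) below_subset[of C E] by blast
        have "k = x \<ominus>\<^bsub>N\<^esub> v"
          using N.eq_minus_if_add_eq(1)[OF Ec[OF vE] _ vk(3)] y h'(1) Qc by blast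
        then have "k \<in> U" using submoduleD(5)[OF D(1)[OF E] x vE] EU by blast
        then have "y \<in> P" using inj[OF y(1)] y(2) N.subset_set_add(1)[OF Us K] by blast
        then have "k \<in> K" using y(2) by (simp add: K_def)
        then have "x \<in> ?V <+>\<^bsub>N\<^esub> K" using vk(1,3) set_addI by metis
        then show ?thesis using EV x by blast
      qed
      then show ?thesis by blast
    next
      case 3
      then have BV: "B \<subseteq> ?V" using B(1) by (auto simp: below_def)
      have "E \<noteq> {\<zero>\<^bsub>N\<^esub>}" using 3 submoduleD(2)[OF Bs] by blast
      then have "?V \<in> C" using D(5)[OF E] E by metis
      note Vs = D(1)[OF this]
      have "h ` Q \<subseteq> ?V <+>\<^bsub>N\<^esub> K" using B(2) set_add_mono[OF BV subset_refl, of N K] by blast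
      then have "?V <+>\<^bsub>N\<^esub> h ` Q \<subseteq> ?V <+>\<^bsub>N\<^esub> K"
        by (rule set_add_least[OF N.submodule_set_add[OF Vs K] N.subset_set_add(1)[OF Vs K]])
      then show ?thesis using EV by blast
    qed
  qed
  then have "chain_compatible N C (h ` Q)" by (simp add: chain_compatible_def)
  moreover have "\<forall>x\<in>Q. h x \<in> h ` P \<longrightarrow> x \<in> P"
    using inj N.subset_set_add(2)[OF Us K] unfolding K_def by blast
  ultimately show ?thesis by blast
qed

subsection \<open>Closure properties\<close>

text \<open>Successors are handled by \<open>chain_compatible_step\<close>. At limits, every element
  of the image of \<open>Q\<close> already comes from a smaller member, so compatibility passes to
  the union.\<close>

lemma chain_compatible_image:
  assumes X: "semibrick R \<X>" and M: "left_module R M" and N: "left_module R N"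
    and h: "h \<in> lmod_hom R M N" and E: "filt_chain R \<X> M E" and C: "filt_chain R \<X> N C"
    and P: "P \<in> E"
  shows "chain_compatible N C (h ` P)"
  using E P
proof (induction rule: filt_chain_induct)
  case (less Q)
  interpret M: left_module R M by fact
  interpret N: left_module R N by fact
  note h' = M.lmod_homD[OF N h] and DE = filt_chainD[OF E] and DC = filt_chainD[OF C]
  let ?P = "below E Q"
  consider "Q = {\<zero>\<^bsub>M\<^esub>}" | "?P = Q" | Y where "?P \<noteq> Q" "?P \<in> E" "Y \<in> \<X>" "factor_by R M ?P Q Y"
    using DE(5)[OF less(1)] by blast
  then show ?case
  proof cases
    case 1
    have "below C B <+>\<^bsub>N\<^esub> {\<zero>\<^bsub>N\<^esub>} \<subseteq> below C B" if B: "B \<in> C" for B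
    proof
      fix x assume "x \<in> below C B <+>\<^bsub>N\<^esub> {\<zero>\<^bsub>N\<^esub>}"
      then obtain v where v: "v \<in> below C B" "x = v \<oplus>\<^bsub>N\<^esub> \<zero>\<^bsub>N\<^esub>" by (auto elim!: set_addE)
      then have "v \<in> carrier N" using below_subset[of C B] submoduleD(1)[OF DC(1)[OF B]] by blast
      then show "x \<in> below C B" using v by simp
    qed
    moreover have "h ` Q = {\<zero>\<^bsub>N\<^esub>}" using 1 h'(4) by simp
    ultimately show ?thesis unfolding chain_compatible_def by (metis inf.coboundedI2)
  next
    case 2
    show ?thesis
      unfolding chain_compatible_def
    proof
      fix B assume B: "B \<in> C"
      show "B \<subseteq> below C B <+>\<^bsub>N\<^esub> h ` Q \<or> B \<inter> (below C B <+>\<^bsub>N\<^esub> h ` Q) \<subseteq> below C B"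
      \<comment> \<open>The alternative may depend on \<open>A\<close>. If one \<open>A\<close>
        fills the factor at \<open>B\<close>, so does \<open>Q\<close>; if none does, the second
        alternative holds for every \<open>A\<close> and hence for their union.\<close>
      proof (cases "\<exists>A\<in>E. A \<subset> Q \<and> B \<subseteq> below C B <+>\<^bsub>N\<^esub> h ` A")
        case True
        then obtain A where A: "A \<subseteq> Q" "B \<subseteq> below C B <+>\<^bsub>N\<^esub> h ` A" by blast
        have "below C B <+>\<^bsub>N\<^esub> h ` A \<subseteq> below C B <+>\<^bsub>N\<^esub> h ` Q"
          by (rule set_add_mono[OF subset_refl image_mono[OF A(1)]])
        then show ?thesis using A(2) by blast
      next
        case False
        have "x \<in> below C B" if x: "x \<in> B" and xQ: "x \<in> below C B <+>\<^bsub>N\<^esub> h ` Q" for x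
        proof -
          obtain v k where vk: "v \<in> below C B" "k \<in> h ` Q" "x = v \<oplus>\<^bsub>N\<^esub> k" using xQ by (rule set_addE)
          obtain y where y: "y \<in> Q" "k = h y" using vk(2) by blast
          then have "y \<in> ?P" using 2 by simp
          then obtain A where A: "A \<in> E" "A \<subset> Q" "y \<in> A" by (auto simp: below_def)
          have "x \<in> below C B <+>\<^bsub>N\<^esub> h ` A"
            unfolding vk(3) using vk(1) y(2) A(3) by (intro set_addI) auto
          moreover have "B \<inter> (below C B <+>\<^bsub>N\<^esub> h ` A) \<subseteq> below C B"
            using less(2)[OF A(1,2)] False A B unfolding chain_compatible_def by blast
          ultimately show ?thesis using x by blast
        qed
        then show ?thesis by blast
      qed
    qed
  next
    case 3
    have "?P \<subset> Q" using 3(1) below_subset[of E Q] by blast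
    then show ?thesis
      using chain_compatible_step[OF X M N h C DE(1)[OF 3(2)] DE(1)[OF less(1)] below_subset 3(3,4)]
        less(2)[OF 3(2)] by blast
  qed
qed

text \<open>At a successor the dichotomy for \<open>h\<close> on \<open>Q / P\<close> translates
  directly: \<open>h Q\<close> inside \<open>h P\<close> means that \<open>Q\<close> lies in
  \<open>P\<close> plus the kernel, and injectivity means that \<open>Q\<close> meets this sum only
  in \<open>P\<close>.\<close>

lemma chain_compatible_kernel:
  assumes X: "semibrick R \<X>" and M: "left_module R M" and N: "left_module R N"
    and h: "h \<in> lmod_hom R M N" and E: "filt_chain R \<X> M E" and C: "filt_chain R \<X> N C"
  shows "chain_compatible M E (a_kernel M N h)"
  unfolding chain_compatible_def
proof
  interpret M: left_module R M by fact
  interpret N: left_module R N by fact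
  note h' = M.lmod_homD[OF N h] and DE = filt_chainD[OF E]
  let ?K = "a_kernel M N h"
  fix Q assume Q: "Q \<in> E"
  let ?P = "below E Q"
  have Qc: "\<And>x. x \<in> Q \<Longrightarrow> x \<in> carrier M" using submoduleD(1)[OF DE(1)[OF Q]] by blast
  consider "Q = {\<zero>\<^bsub>M\<^esub>}" | "?P = Q" | Y where "?P \<noteq> Q" "?P \<in> E" "Y \<in> \<X>" "factor_by R M ?P Q Y"
    using DE(5)[OF Q] by blast
  then show "Q \<subseteq> ?P <+>\<^bsub>M\<^esub> ?K \<or> Q \<inter> (?P <+>\<^bsub>M\<^esub> ?K) \<subseteq> ?P"
  proof cases
    case 1
    \<comment> \<open>Every member contains zero, so none lies strictly below the zero submodule;
      the sum with an empty set is empty as well.\<close>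
    have "?P = {}"
      unfolding below_def using 1 submoduleD(2)[OF DE(1)] by auto
    then show ?thesis by (auto elim!: set_addE)
  next
    case 3
    have Pc: "\<And>x. x \<in> ?P \<Longrightarrow> x \<in> carrier M" using below_subset[of E Q] Qc by blast
    have "h ` Q \<subseteq> h ` ?P \<or> (\<forall>x\<in>Q. h x \<in> h ` ?P \<longrightarrow> x \<in> ?P)"
      using chain_compatible_step[OF X M N h C DE(1)[OF 3(2)] DE(1)[OF Q] below_subset 3(3,4)
          chain_compatible_image[OF X M N h E C 3(2)]] by blast
    then show ?thesis
    proof
      assume sub: "h ` Q \<subseteq> h ` ?P"
      have "x \<in> ?P <+>\<^bsub>M\<^esub> ?K" if x: "x \<in> Q" for x
      proof -
        obtain y where y: "y \<in> ?P" "h x = h y" using sub x by blast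
        have c: "x \<in> carrier M" "y \<in> carrier M" using Qc[OF x] Pc[OF y(1)] .
        then have "h (x \<ominus>\<^bsub>M\<^esub> y) = \<zero>\<^bsub>N\<^esub>" using h'(5) h'(1) y(2) N.a_minus_eq_zero_iff by simp
        then have "x \<ominus>\<^bsub>M\<^esub> y \<in> ?K" using c by (simp add: a_kernel_def')
        then have "y \<oplus>\<^bsub>M\<^esub> (x \<ominus>\<^bsub>M\<^esub> y) \<in> ?P <+>\<^bsub>M\<^esub> ?K" using y(1) by (intro set_addI)
        moreover have "y \<oplus>\<^bsub>M\<^esub> (x \<ominus>\<^bsub>M\<^esub> y) = x"
          using M.a_minus_add_cancel[OF c] c M.M.a_comm by simp
        ultimately show ?thesis by simp
      qed
      then show ?thesis by blast
    next
      assume inj: "\<forall>x\<in>Q. h x \<in> h ` ?P \<longrightarrow> x \<in> ?P"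
      have "x \<in> ?P" if x: "x \<in> Q" and xP: "x \<in> ?P <+>\<^bsub>M\<^esub> ?K" for x
      proof -
        obtain y k where yk: "y \<in> ?P" "k \<in> ?K" "x = y \<oplus>\<^bsub>M\<^esub> k" using xP by (rule set_addE)
        have k: "k \<in> carrier M" "h k = \<zero>\<^bsub>N\<^esub>" using yk(2) by (auto simp: a_kernel_def')
        have "h x = h y" using h'(1,2) Pc[OF yk(1)] k yk(3) by simp
        then show ?thesis using inj x yk(1) by blast
      qed
      then show ?thesis by blast
    qed
  qed auto
qed

section \<open>Transfer of compatibility and of exact sequences to \<open>Filt\<close>\<close>

lemma Filt_if_chain_compatible:
  assumes X: "semibrick R \<X>" and M: "left_module R M" and C: "filt_chain R \<X> M C"
    and K: "submodule K R M" and cc: "chain_compatible M C K"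
  shows "M\<lparr>carrier := K\<rparr> \<in> Filt R \<X>"
  using filt_chain_imp_Filt[OF X left_module.submodule_left_module[OF M K]
      filt_chain_restrict[OF M C _ K cc]] semibrickD(1)[OF X] by blast

lemma Filt_image:
  assumes X: "semibrick R \<X>" and "M \<in> Filt R \<X>" "N \<in> Filt R \<X>" and f: "f \<in> lmod_hom R M N"
  shows "N\<lparr>carrier := f ` carrier M\<rparr> \<in> Filt R \<X>"
proof -
  obtain E where M: "left_module R M" and E: "filt_chain R \<X> M E"
    using Filt_imp_filt_chain[OF X assms(2)] .
  obtain C where N: "left_module R N" and C: "filt_chain R \<X> N C"
    using Filt_imp_filt_chain[OF X assms(3)] .
  show ?thesis
    by (rule Filt_if_chain_compatible[OF X N C
          left_module.submodule_image[OF M N f left_module.submodule_carrier[OF M]]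
          chain_compatible_image[OF X M N f E C filt_chainD(4)[OF E]]])
qed

lemma Filt_kernel:
  assumes X: "semibrick R \<X>" and "M \<in> Filt R \<X>" "N \<in> Filt R \<X>" and f: "f \<in> lmod_hom R M N"
  shows "M\<lparr>carrier := a_kernel M N f\<rparr> \<in> Filt R \<X>"
proof -
  obtain E where M: "left_module R M" and E: "filt_chain R \<X> M E"
    using Filt_imp_filt_chain[OF X assms(2)] .
  obtain C where N: "left_module R N" and C: "filt_chain R \<X> N C"
    using Filt_imp_filt_chain[OF X assms(3)] .
  have "submodule {x \<in> carrier M. f x \<in> {\<zero>\<^bsub>N\<^esub>}} R M"
    by (rule left_module.submodule_vimage[OF M N f left_module.submodule_zero[OF N]])
  then have "submodule (a_kernel M N f) R M" by (simp add: a_kernel_def')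
  then show ?thesis
    using Filt_if_chain_compatible[OF X M E] chain_compatible_kernel[OF X M N f E C] by blast
qed

text \<open>Place the chain of \<open>L\<close>, carried into \<open>E\<close> by \<open>f\<close>,
  below the preimages under \<open>g\<close> of the chain of \<open>N\<close>. Exactness makes the
  top of the lower part equal to the bottom of the upper part, and all factors are
  inherited.\<close>

lemma Filt_extension:
  assumes X: "semibrick R \<X>" and se: "short_exact R L f E g N"
    and LX: "L \<in> Filt R \<X>" and NX: "N \<in> Filt R \<X>"
  shows "E \<in> Filt R \<X>"
proof -
  have L: "left_module R L" and E: "left_module R E" and N: "left_module R N"
    and f: "f \<in> lmod_hom R L E" and g: "g \<in> lmod_hom R E N" and inj: "inj_on f (carrier L)"
    and ex: "f ` carrier L = a_kernel E N g" and onto: "g ` carrier E = carrier N"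
    using se by (auto simp: short_exact_def)
  interpret L: left_module R L by fact
  interpret E: left_module R E by fact
  interpret N: left_module R N by fact
  obtain C1 where C1: "filt_chain R \<X> L C1" using Filt_imp_filt_chain[OF X LX] .
  obtain C2 where C2: "filt_chain R \<X> N C2" using Filt_imp_filt_chain[OF X NX] .
  note D1 = filt_chainD[OF C1] and D2 = filt_chainD[OF C2]
  note f' = L.lmod_homD[OF E f] and g' = E.lmod_homD[OF N g]
  define v where "v B = {x \<in> carrier E. g x \<in> B}" for B
  define C where "C = (`) f ` C1 \<union> v ` C2"
  have sub1: "A \<subseteq> carrier L" if "A \<in> C1" for A using submoduleD(1)[OF D1(1)[OF that]] .
  have sub2: "A \<subseteq> carrier N" if "A \<in> C2" for A using submoduleD(1)[OF D2(1)[OF that]] .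
  have f_sub: "A \<subseteq> B" if "A \<in> C1" "B \<in> C1" "f ` A \<subseteq> f ` B" for A B
    using inj sub1[OF that(1)] sub1[OF that(2)] that(3) unfolding inj_on_def by blast
  have f_iff: "f ` A \<subset> f ` B \<longleftrightarrow> A \<subset> B" if "A \<in> C1" "B \<in> C1" for A B
    using f_sub[OF that] f_sub[OF that(2,1)] by (auto simp: less_le_not_le)
  have gv: "g ` v B = B" if "B \<in> C2" for B
    using sub2[OF that] onto by (auto simp: v_def)
  have v_mono: "v A \<subseteq> v B" if "A \<subseteq> B" for A B using that by (auto simp: v_def)
  have v_sub: "A \<subseteq> B" if "A \<in> C2" "B \<in> C2" "v A \<subseteq> v B" for A B
    using image_mono[OF that(3), of g] gv[OF that(1)] gv[OF that(2)] by simp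
  have v_iff: "v A \<subset> v B \<longleftrightarrow> A \<subset> B" if "A \<in> C2" "B \<in> C2" for A B
    using v_sub[OF that] v_sub[OF that(2,1)] v_mono by (auto simp: less_le_not_le)
  \<comment> \<open>The gluing point: the kernel of \<open>g\<close> is the top of the first chain
    and the bottom of the second.\<close>
  have v0: "v {\<zero>\<^bsub>N\<^esub>} = f ` carrier L" unfolding ex by (auto simp: v_def a_kernel_def')
  have fv: "f ` A \<subseteq> v B" if "A \<in> C1" "B \<in> C2" for A B
  proof -
    have "f ` A \<subseteq> v {\<zero>\<^bsub>N\<^esub>}" unfolding v0 using sub1[OF that(1)] by blast
    then show ?thesis using v_mono[of "{\<zero>\<^bsub>N\<^esub>}" B] submoduleD(2)[OF D2(1)[OF that(2)]] by blast
  qed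
  have bel1: "below C (f ` B) = f ` below C1 B" if B: "B \<in> C1" for B
  proof -
    have "{A \<in> C. A \<subset> f ` B} = (`) f ` {A \<in> C1. A \<subset> B}"
    proof (intro equalityI subsetI)
      fix A assume A: "A \<in> {A \<in> C. A \<subset> f ` B}"
      then have "A \<notin> v ` C2" using fv[OF B] by auto
      then obtain A1 where A1: "A1 \<in> C1" "A = f ` A1" using A by (auto simp: C_def)
      then have "A1 \<subset> B" using A f_iff[OF A1(1) B] by simp
      then show "A \<in> (`) f ` {A \<in> C1. A \<subset> B}" using A1 by simp
    next
      fix A assume "A \<in> (`) f ` {A \<in> C1. A \<subset> B}"
      then obtain A1 where A1: "A1 \<in> C1" "A1 \<subset> B" "A = f ` A1" by blast
      then show "A \<in> {A \<in> C. A \<subset> f ` B}" using f_iff[OF A1(1) B] by (simp add: C_def)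
    qed
    then show ?thesis by (auto simp: below_def)
  qed
  have bel2: "below C (v B) = v (below C2 B)" if B: "B \<in> C2" "B \<noteq> {\<zero>\<^bsub>N\<^esub>}" for B
  proof (intro equalityI subsetI)
    have Z: "{\<zero>\<^bsub>N\<^esub>} \<in> {A \<in> C2. A \<subset> B}"
      using D2(3) B(2) submoduleD(2)[OF D2(1)[OF B(1)]] by blast
    fix x
    {
      assume "x \<in> below C (v B)"
      then obtain A where A: "A \<in> C" "A \<subset> v B" "x \<in> A" by (auto simp: below_def)
      have "\<exists>A'\<in>C2. A' \<subset> B \<and> x \<in> v A'"
      proof (cases "A \<in> v ` C2")
        case True
        then obtain A' where A': "A' \<in> C2" "A = v A'" by blast
        then show ?thesis using A v_iff[OF A'(1) B(1)] by (intro bexI[of _ A']) auto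
      next
        case False
        then obtain A1 where A1: "A1 \<in> C1" "A = f ` A1" using A(1) by (auto simp: C_def)
        then have "x \<in> v {\<zero>\<^bsub>N\<^esub>}" using fv[OF A1(1) D2(3)] A(3) by auto
        then show ?thesis using Z by (intro bexI[of _ "{\<zero>\<^bsub>N\<^esub>}"]) auto
      qed
      then show "x \<in> v (below C2 B)" by (auto simp: v_def below_def)
    next
      assume "x \<in> v (below C2 B)"
      then obtain A where A: "A \<in> C2" "A \<subset> B" "x \<in> v A" by (auto simp: v_def below_def)
      then have "v A \<in> C" "v A \<subset> v B" using v_iff[OF A(1) B(1)] by (auto simp: C_def)
      then show "x \<in> below C (v B)" using A(3) by (auto simp: below_def)
    }
  qed
  have step1: "B = {\<zero>\<^bsub>E\<^esub>} \<or> below C B = B \<or>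
       below C B \<in> C \<and> (\<exists>X\<in>\<X>. factor_by R E (below C B) B X)" if B: "B \<in> (`) f ` C1" for B
  proof -
    obtain B1 where B1: "B1 \<in> C1" "B = f ` B1" using B by blast
    consider "B1 = {\<zero>\<^bsub>L\<^esub>}" | "below C1 B1 = B1"
      | Y where "below C1 B1 \<in> C1" "Y \<in> \<X>" "factor_by R L (below C1 B1) B1 Y"
      using D1(5)[OF B1(1)] by blast
    then show ?thesis
    proof cases
      case 1
      then show ?thesis using f'(4) B1 by simp
    next
      case 2
      then show ?thesis using bel1[OF B1(1)] B1(2) by simp
    next
      case 3
      have c: "\<And>x. x \<in> B1 \<Longrightarrow> x \<in> carrier L" using sub1[OF B1(1)] by blast
      note B1s = submoduleD[OF D1(1)[OF B1(1)]]
      obtain p where p: "p \<in> lmod_hom R (L\<lparr>carrier := B1\<rparr>) Y" and p_onto: "p ` B1 = carrier Y"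
        and p_ker: "\<And>x. x \<in> B1 \<Longrightarrow> p x = \<zero>\<^bsub>Y\<^esub> \<longleftrightarrow> x \<in> below C1 B1"
        using 3(3) by (auto simp: factor_by_def)
      note p' = L.lmod_hom_restrictD[OF D1(1)[OF B1(1)] semibrickD(1)[OF X 3(2)] p]
      let ?i = "the_inv_into (carrier L) f"
      have i: "?i (f x) = x" if "x \<in> carrier L" for x using inj that by (rule the_inv_into_f_f)
      \<comment> \<open>The factor map of \<open>L\<close> is transported along the inverse of the
        injection \<open>f\<close>.\<close>
      let ?q = "\<lambda>y. p (?i y)"
      have q: "?q (f x) = p x" if "x \<in> B1" for x using i[OF c[OF that]] by simp
      have "?q \<in> lmod_hom R (E\<lparr>carrier := B\<rparr>) Y"
        unfolding lmod_hom_def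
      proof (intro CollectI conjI ballI funcsetI)
        fix y assume "y \<in> carrier (E\<lparr>carrier := B\<rparr>)"
        then obtain x where x: "x \<in> B1" "y = f x" using B1 by auto
        then show "?q y \<in> carrier Y" using q p'(1) by simp
        fix y' assume "y' \<in> carrier (E\<lparr>carrier := B\<rparr>)"
        then obtain x' where x': "x' \<in> B1" "y' = f x'" using B1 by auto
        have "y \<oplus>\<^bsub>E\<^esub> y' = f (x \<oplus>\<^bsub>L\<^esub> x')" using f'(2) x x' c by simp
        then show "?q (y \<oplus>\<^bsub>E\<lparr>carrier := B\<rparr>\<^esub> y') = ?q y \<oplus>\<^bsub>Y\<^esub> ?q y'"
          using q[OF B1s(3)[OF x(1) x'(1)]] p'(2) x x' q by simp
      next
        fix a y assume a: "a \<in> carrier R" and "y \<in> carrier (E\<lparr>carrier := B\<rparr>)"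
        then obtain x where x: "x \<in> B1" "y = f x" using B1 by auto
        have "a \<odot>\<^bsub>E\<^esub> y = f (a \<odot>\<^bsub>L\<^esub> x)" using f'(3) a x c by simp
        then show "?q (a \<odot>\<^bsub>E\<lparr>carrier := B\<rparr>\<^esub> y) = a \<odot>\<^bsub>Y\<^esub> ?q y"
          using q[OF B1s(6)[OF a x(1)]] p'(3) a x q by simp
      qed
      moreover have "?q ` B = carrier Y" using q p_onto by (force simp: B1(2) image_image)
      moreover have "?q y = \<zero>\<^bsub>Y\<^esub> \<longleftrightarrow> y \<in> f ` below C1 B1" if "y \<in> B" for y
      proof -
        obtain x where x: "x \<in> B1" "y = f x" using \<open>y \<in> B\<close> B1 by auto
        have "f x \<in> f ` below C1 B1 \<longleftrightarrow> x \<in> below C1 B1"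
          using inj_on_image_mem_iff[OF inj c[OF x(1)] sub1[OF 3(1)]] .
        then show ?thesis using q[OF x(1)] p_ker[OF x(1)] x(2) by simp
      qed
      ultimately have "factor_by R E (below C B) B Y"
        unfolding factor_by_def using bel1[OF B1(1)] B1(2) by (intro bexI[of _ ?q]) simp_all
      moreover have "below C B \<in> C" using 3(1) bel1[OF B1(1)] B1(2) by (simp add: C_def)
      ultimately show ?thesis using 3(2) by blast
    qed
  qed
  have step2: "B = {\<zero>\<^bsub>E\<^esub>} \<or> below C B = B \<or>
       below C B \<in> C \<and> (\<exists>X\<in>\<X>. factor_by R E (below C B) B X)" if B: "B \<in> v ` C2" for B
  proof -
    obtain B2 where B2: "B2 \<in> C2" "B = v B2" using B by blast
    consider "B2 = {\<zero>\<^bsub>N\<^esub>}" | "B2 \<noteq> {\<zero>\<^bsub>N\<^esub>}" "below C2 B2 = B2"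
      | Y where "B2 \<noteq> {\<zero>\<^bsub>N\<^esub>}" "below C2 B2 \<in> C2" "Y \<in> \<X>" "factor_by R N (below C2 B2) B2 Y"
      using D2(5)[OF B2(1)] by blast
    then show ?thesis
    proof cases
      case 1
      \<comment> \<open>The bottom of the second chain is the top of the first, so its step is one
        of \<open>L\<close>.\<close>
      then have "B \<in> (`) f ` C1" using v0 D1(4) B2(2) by simp
      then show ?thesis by (rule step1)
    next
      case 2
      then show ?thesis using bel2[OF B2(1)] B2(2) by simp
    next
      case 3
      obtain p where p: "p \<in> lmod_hom R (N\<lparr>carrier := B2\<rparr>) Y" and p_onto: "p ` B2 = carrier Y"
        and p_ker: "\<And>x. x \<in> B2 \<Longrightarrow> p x = \<zero>\<^bsub>Y\<^esub> \<longleftrightarrow> x \<in> below C2 B2"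
        using 3(4) by (auto simp: factor_by_def)
      \<comment> \<open>Composing with \<open>g\<close> keeps surjectivity, and the kernel becomes
        the preimage of the old one.\<close>
      let ?q = "\<lambda>y. p (g y)"
      have "?q \<in> lmod_hom R (E\<lparr>carrier := B\<rparr>) Y"
        using p g'(2,3) unfolding B2(2) v_def lmod_hom_def by auto
      moreover have "?q ` B = carrier Y"
        using p_onto gv[OF B2(1)] by (simp add: B2(2) flip: image_image)
      moreover have "?q y = \<zero>\<^bsub>Y\<^esub> \<longleftrightarrow> y \<in> v (below C2 B2)" if "y \<in> B" for y
        using that p_ker by (simp add: B2(2) v_def)
      ultimately have "factor_by R E (below C B) B Y"
        unfolding factor_by_def using bel2[OF B2(1) 3(1)] B2(2) by (intro bexI[of _ ?q]) simp_all
      moreover have "below C B \<in> C" using 3(2) bel2[OF B2(1) 3(1)] B2(2) by (simp add: C_def)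
      ultimately show ?thesis using 3(3) by blast
    qed
  qed
  have "filt_chain R \<X> E C"
    unfolding filt_chain_def
  proof (intro conjI ballI allI impI)
    fix A assume "A \<in> C"
    then show "submodule A R E"
      using L.submodule_image[OF E f D1(1)] E.submodule_vimage[OF N g D2(1)]
      by (auto simp: C_def v_def)
  next
    fix D assume D: "D \<subseteq> C" "D \<noteq> {}"
    show "\<exists>A\<in>D. \<forall>B\<in>D. A \<subseteq> B"
    \<comment> \<open>Members of the first chain lie under all those of the second, so the least
      element of \<open>D\<close> is sought there whenever \<open>D\<close> meets it.\<close>
    proof (cases "{A \<in> C1. f ` A \<in> D} = {}")
      case False
      then have "\<exists>A\<in>{A \<in> C1. f ` A \<in> D}. \<forall>B\<in>{A \<in> C1. f ` A \<in> D}. A \<subseteq> B" by (intro D1(2)) auto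
      then obtain A where A: "A \<in> C1" "f ` A \<in> D" "\<And>B. B \<in> C1 \<Longrightarrow> f ` B \<in> D \<Longrightarrow> A \<subseteq> B" by auto
      have "f ` A \<subseteq> B" if "B \<in> D" for B
      proof (cases "B \<in> v ` C2")
        case True
        then show ?thesis using fv[OF A(1)] by auto
      next
        case False
        then obtain B' where "B' \<in> C1" "B = f ` B'" using D(1) \<open>B \<in> D\<close> by (auto simp: C_def)
        then show ?thesis using A(3) \<open>B \<in> D\<close> by auto
      qed
      then show ?thesis using A(2) by blast
    next
      case True
      then have Dv: "D \<subseteq> v ` C2" using D(1) by (auto simp: C_def)
      let ?S = "{A \<in> C2. v A \<in> D}"
      have "?S \<noteq> {}" using Dv D(2) by auto
      then have "\<exists>A\<in>?S. \<forall>B\<in>?S. A \<subseteq> B" by (intro D2(2)) auto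
      then obtain A where A: "A \<in> ?S" "\<forall>B\<in>?S. A \<subseteq> B" by blast
      have "v A \<subseteq> B" if "B \<in> D" for B
      proof -
        obtain B' where "B' \<in> C2" "B = v B'" using Dv \<open>B \<in> D\<close> by auto
        then show ?thesis using A(2) \<open>B \<in> D\<close> v_mono by simp
      qed
      then show ?thesis using A(1) by blast
    qed
  next
    show "{\<zero>\<^bsub>E\<^esub>} \<in> C"
      unfolding C_def using D1(3) f'(4) by (intro UnI1 image_eqI[of _ _ "{\<zero>\<^bsub>L\<^esub>}"]) auto
    have "v (carrier N) = carrier E" using g'(1) by (auto simp: v_def)
    then show "carrier E \<in> C" unfolding C_def using D2(4) by (metis UnI2 imageI)
  next
    fix B assume "B \<in> C"
    then show "B = {\<zero>\<^bsub>E\<^esub>} \<or> below C B = B \<or>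
       below C B \<in> C \<and> (\<exists>X\<in>\<X>. factor_by R E (below C B) B X)"
      using step1 step2 unfolding C_def by (elim UnE) simp_all
  qed
  then show ?thesis by (rule filt_chain_imp_Filt[OF X E])
qed

theorem proposition3p9:
  fixes R :: "('a, 'r) ring_scheme" and \<X> :: "('a, 'x) module set"
  assumes "ring R" and "semibrick R \<X>"
  shows "(\<forall>(L :: ('a, 'l) module) f (E :: ('a, 'e) module) g (N :: ('a, 'n) module).
            short_exact R L f E g N \<and> L \<in> Filt R \<X> \<and> N \<in> Filt R \<X> \<longrightarrow> E \<in> Filt R \<X>) \<and>
         (\<forall>(M :: ('a, 'm) module) (N :: ('a, 'n) module) f.
            M \<in> Filt R \<X> \<and> N \<in> Filt R \<X> \<and> f \<in> lmod_hom R M N \<longrightarrow>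
            M\<lparr>carrier := a_kernel M N f\<rparr> \<in> Filt R \<X>) \<and>
         (\<forall>(M :: ('a, 'm) module) (N :: ('a, 'n) module) f.
            M \<in> Filt R \<X> \<and> N \<in> Filt R \<X> \<and> f \<in> lmod_hom R M N \<longrightarrow>
            N\<lparr>carrier := f ` carrier M\<rparr> \<in> Filt R \<X>)"
  using assms(2) by (auto intro: Filt_extension Filt_kernel Filt_image)

end
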